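(* Consider the setting and the family of local stationary Pontryagin branches described in the context, and define $$\mathsf K_T(x_{\rm in},y):=u_0(x_{\rm in},y),$$ the first control of the local stationary branch with initial state $x_{\rm in}$ and parameter $y$. After possibly shrinking the neighborhood of the endpoint data (independently of $T$), there is a constant $\Lambda$ independent of $(T,y)$ such that, for every fixed admissible $y$, every $T\ge T_0$, and every two admissible initial states $x_1,x_2$, $$\|\mathsf K_T(x_1,y)-\mathsf K_T(x_2,y)\|\le \Lambda\|x_1-x_2\| .$$ If, in addition, $y\mapsto r_x(x,y)$ and $y\mapsto r_{xx}(x,y)$ are locally Lipschitz uniformly in $x$ on the terminal tube $x_\infty+B_x$, then for arbitrary admissible $(x_1,y_1)$ and $(x_2,y_2)$, $$\|\mathsf K_T(x_1,y_1)-\mathsf K_T(x_2,y_2)\|\le \Lambda\|x_1-x_2\|+\Lambda\|y_1-y_2\| .$$ Moreover, for each fixed $y$, with $\Delta_{\rm oc}=\Delta_{\rm oc}(x_{\rm in},y)$ and $z^{\rm lin}_{T,y}(\Delta_{\rm oc})=(\xi^{\rm lin},\pi^{\rm lin})$ the linearized branch formed with $D\mathcal B_y(0,0)$, i.e. the solution of $L[h_t,h_{t+1}]=0$ $(0\le t<T)$, $D\mathcal B_y(0,0)[h_0,h_T]=\Delta_{\rm oc}$, $$\mathsf K_T(x_{\rm in},y)=u_\infty+D\nu(x_\infty,p_\infty)[\xi_0^{\rm lin},\pi_1^{\rm lin}]+O(\|\Delta_{\rm oc}(x_{\rm in},y)\|^2),$$ with a constant independent of $(T,y)$.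
   Context: Setting. $U\subset\mathbb R^m$ is compact and convex, $Y\subset\mathbb R^q$ open, $\lambda>0$. Dynamics $x_{t+1}=F(x_t,u_t)\in\mathbb R^d$, running cost $\ell$, terminal reward $r(x,y)$, Hamiltonian $H(x,u,p)=-\lambda\ell(x,u)+\langle p,F(x,u)\rangle$. Reference: $x_\infty=F(x_\infty,u_\infty)$, $p_\infty=H_x(x_\infty,u_\infty,p_\infty)$, $H_u(x_\infty,u_\infty,p_\infty)=0$, $u_\infty\in\operatorname{int}U$. $F,\ell$ are $C^3$ near the reference, $r(\cdot,y)$ is $C^3$ in $x$, $\det H_{uu}(x_\infty,u_\infty,p_\infty)\ne0$. By the implicit function theorem there are neighborhoods $\Omega$ of $(x_\infty,p_\infty)$, $V$ of $u_\infty$ (relatively compact in $\operatorname{int}U$) and a unique $C^2$ map $\nu:\Omega\to V$ with $H_u(x,\nu(x,p_+),p_+)=0$, $\nu(x_\infty,p_\infty)=u_\infty$. Put $$\mathcal F((x,p),(x^+,p^+))=\binom{x^+-F(x,\nu(x,p^+))}{p-H_x(x,\nu(x,p^+),p^+)},\quad \widetilde{\mathcal F}(z,z^+)=\mathcal F((x_\infty,p_\infty)+z,(x_\infty,p_\infty)+z^+),\quad L=D\widetilde{\mathcal F}(0,0).$$ Uniform local assumptions. $y_\infty\in Y$ satisfies $p_\infty=r_x(x_\infty,y_\infty)$. A product neighborhood $Z=Z_x\times Z_p$ of $0$ in $\Omega-(x_\infty,p_\infty)$, a convex $U_0$ relatively compact in $\operatorname{int}U$, compact balls $B_x\subset Z_x$,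 $B_p\subset Z_p$ about $0$, and a neighborhood $Y_0$ of $y_\infty$ relatively compact in $Y$ are fixed so that $\nu$ maps all $(x_\infty+\xi,p_\infty+\pi^+)$ into $U_0$; $\sup\|D\nu\|+\sup\|D^2\nu\|\le M_{\rm int}$ on $(x_\infty,p_\infty)+Z$; $\|D^2\widetilde{\mathcal F}\|\le M_{\rm int}$ on $(B_x\times B_p)^2$; $\|D_x^jr\|\le M_{\rm ter}$ on $(x_\infty+B_x)\times Y_0$, $j=1,2,3$; $y\mapsto r_x(x,y)$, $r_{xx}(x,y)$ are continuous uniformly for $x\in x_\infty+B_x$. Norms are Euclidean (product norm on $\mathbb R^{2d}$). Uniform Green property. A linear $L:\mathbb R^{n}\times\mathbb R^{n}\to\mathbb R^{n}$ and rows $\mathsf B_0,\mathsf B_T\in\mathbb R^{n\times n}$ have it with constants $C_G\ge1,\gamma>0,T_0\ge1$ if for every $T\ge T_0$ and all $f_t,b\in\mathbb R^n$ the problem $L[h_t,h_{t+1}]=f_t$ $(0\le t<T)$, $\mathsf B_0h_0+\mathsf B_Th_T=b$ has a unique solution and $\|h_t\|\le C_G[(e^{-\gamma t}+e^{-\gamma(T-t)})\|b\|+\sum_{s=0}^{T-1}\kappa_T(t,s)\|f_s\|]$ for $0\le t\le T$, where $\kappa_T(t,s)=e^{-\gamma|t-s|}+e^{-\gamma(t+T-s)}+e^{-\gamma(T-t+s)}$. Branches. For $z=(\xi,\pi)=(x-x_\infty,p-p_\infty)$ let $$\mathcal B_y(z_0,z_T)=\binom{\xi_0}{\pi_T-(r_x(x_\infty+\xi_T,y)-r_x(x_\infty,y))},\qquad\Delta_{\rm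 oc}(x_{\rm in},y)=\binom{x_{\rm in}-x_\infty}{r_x(x_\infty,y)-p_\infty}.$$ Assume $(L,D\mathcal B_{y_\infty}(0,0))$ has the uniform Green property with constants $(C_G,\gamma,T_0)$ ($n=2d$). Let $Y_1$ be a neighborhood of $y_\infty$, relatively compact in $Y_0$, with $\bar\vartheta:=2C_G\sup_{y\in Y_1}\|r_{xx}(x_\infty,y)-r_{xx}(x_\infty,y_\infty)\|<1$, and $\bar C_G=C_G\frac{1+\bar\vartheta}{1-\bar\vartheta}$. Fix $0<\alpha<\gamma/2$, $w_T(t)=e^{-\alpha t}+e^{-\alpha(T-t)}$, $\|z\|_{w,T}=\max_t\|z_t\|/w_T(t)$. Let $C_N$ be a constant with $\|N(a,b)\|\le C_N(\|a\|+\|b\|)^2$ and $\|N(a,b)-N(\tilde a,\tilde b)\|\le C_N(\|a\|+\|b\|+\|\tilde a\|+\|\tilde b\|)(\|a-\tilde a\|+\|b-\tilde b\|)$ on the tube, $N=\widetilde{\mathcal F}-L$; $C_{\rm conv}=4\bigl(\frac1{1-q_-}+\frac{q_+}{1-q_+}\bigr)$, $q_\pm=e^{-(\gamma\pm2\alpha)}$; $c=\bar C_G$, $a=2\bar C_GC_{\rm conv}C_N(1+e^\alpha)^2+16\bar C_GM_{\rm ter}$; $R_*>0$ is such that $2aR_*<1$ and $\|z\|_{w,T}\le R_*$ implies $z_t\in B_x\times B_p$ for all $t$; $\delta_*=(R_*-aR_*^2)/c$. For every $T\ge T_0$ and every $(x_{\rm in},y)$ with $y\in Y_1$, $\|\Delta_{\rm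 oc}(x_{\rm in},y)\|<\delta_*$ (the admissible endpoint data), there is exactly one $z$ with $\|z\|_{w,T}\le R_*$ such that, with $u_t=\nu(x_t,p_{t+1})$, one has $x_{t+1}=F(x_t,u_t)$, $p_t=H_x(x_t,u_t,p_{t+1})$, $H_u(x_t,u_t,p_{t+1})=0$ $(0\le t<T)$, $x_0=x_{\rm in}$, $p_T=r_x(x_T,y)$; this is the local stationary branch. "Shrinking the neighborhood of the endpoint data" means replacing this set of $(x_{\rm in},y)$ by a smaller $T$-independent neighborhood of $(x_\infty,y_\infty)$. *)

theory Defs
  imports "HOL-Analysis.Analysis"
begin

text \<open>The total derivative as a bounded linear map; it is meaningful only where the function is
  differentiable. Iterating it puts the \<open>k\<close>-th derivative into the nested type
  \<open>'a \<Rightarrow>\<^sub>L \<dots> \<Rightarrow>\<^sub>L 'b\<close>, whose norm is the operator norm of the corresponding multilinear map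
  (for the Euclidean norms of the underlying spaces).\<close>

definition fderiv :: "('a::real_normed_vector \<Rightarrow> 'b::real_normed_vector) \<Rightarrow> 'a \<Rightarrow> 'a \<Rightarrow>\<^sub>L 'b" where
  "fderiv f x = Blinfun (frechet_derivative f (at x))"

definition grad :: "(real^'n \<Rightarrow> real) \<Rightarrow> real^'n \<Rightarrow> real^'n" where
  "grad f x = (\<chi> i. frechet_derivative f (at x) (axis i 1))"

text \<open>These are meant for open \<open>S\<close>.\<close>

definition C1_on :: "('a::real_normed_vector \<Rightarrow> 'b::real_normed_vector) \<Rightarrow> 'a set \<Rightarrow> bool" where
  "C1_on f S \<longleftrightarrow> (\<forall>x\<in>S. f differentiable (at x)) \<and> continuous_on S (fderiv f)"

definition C2_on :: "('a::real_normed_vector \<Rightarrow> 'b::real_normed_vector) \<Rightarrow> 'a set \<Rightarrow> bool" where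
  "C2_on f S \<longleftrightarrow> C1_on f S \<and> C1_on (fderiv f) S"

definition C3_on :: "('a::real_normed_vector \<Rightarrow> 'b::real_normed_vector) \<Rightarrow> 'a set \<Rightarrow> bool" where
  "C3_on f S \<longleftrightarrow> C1_on f S \<and> C2_on (fderiv f) S"

type_synonym 'd phase = "(real^'d) \<times> (real^'d)"

definition hamiltonian ::
  "real \<Rightarrow> ((real^'d) \<times> (real^'m) \<Rightarrow> real^'d) \<Rightarrow> ((real^'d) \<times> (real^'m) \<Rightarrow> real)
    \<Rightarrow> real^'d \<Rightarrow> real^'m \<Rightarrow> real^'d \<Rightarrow> real" where
  "hamiltonian lam F l x u p = - lam * l (x, u) + p \<bullet> F (x, u)"

definition ham_x ::
  "(real^'d \<Rightarrow> real^'m \<Rightarrow> real^'d \<Rightarrow> real) \<Rightarrow> real^'d \<Rightarrow> real^'m \<Rightarrow> real^'d \<Rightarrow> real^'d" where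
  "ham_x H x u p = grad (\<lambda>x'. H x' u p) x"

definition ham_u ::
  "(real^'d \<Rightarrow> real^'m \<Rightarrow> real^'d \<Rightarrow> real) \<Rightarrow> real^'d \<Rightarrow> real^'m \<Rightarrow> real^'d \<Rightarrow> real^'m" where
  "ham_u H x u p = grad (\<lambda>u'. H x u' p) u"

definition ham_uu ::
  "(real^'d \<Rightarrow> real^'m \<Rightarrow> real^'d \<Rightarrow> real) \<Rightarrow> real^'d \<Rightarrow> real^'m \<Rightarrow> real^'d \<Rightarrow> (real^'m) \<Rightarrow>\<^sub>L (real^'m)" where
  "ham_uu H x u p = fderiv (\<lambda>u'. ham_u H x u' p) u"

definition pmp_residual ::
  "((real^'d) \<times> (real^'m) \<Rightarrow> real^'d) \<Rightarrow> (real^'d \<Rightarrow> real^'m \<Rightarrow> real^'d \<Rightarrow> real)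
    \<Rightarrow> ('d phase \<Rightarrow> real^'m)
    \<Rightarrow> 'd phase \<times> 'd phase \<Rightarrow> 'd phase" where
  "pmp_residual F H \<nu> = (\<lambda>((x, p), (x', p')).
     (x' - F (x, \<nu> (x, p')), p - ham_x H x (\<nu> (x, p')) p'))"

definition shifted_residual ::
  "((real^'d) \<times> (real^'m) \<Rightarrow> real^'d) \<Rightarrow> (real^'d \<Rightarrow> real^'m \<Rightarrow> real^'d \<Rightarrow> real)
    \<Rightarrow> ('d phase \<Rightarrow> real^'m) \<Rightarrow> 'd phase
    \<Rightarrow> 'd phase \<times> 'd phase \<Rightarrow> 'd phase" where
  "shifted_residual F H \<nu> zinf = (\<lambda>(z, z'). pmp_residual F H \<nu> (zinf + z, zinf + z'))"

definition rew_x :: "(real^'d \<Rightarrow> real^'q \<Rightarrow> real) \<Rightarrow> real^'d \<Rightarrow> real^'q \<Rightarrow> real^'d" where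
  "rew_x r x y = grad (\<lambda>x'. r x' y) x"

definition rew_xx :: "(real^'d \<Rightarrow> real^'q \<Rightarrow> real) \<Rightarrow> real^'d \<Rightarrow> real^'q \<Rightarrow> (real^'d) \<Rightarrow>\<^sub>L (real^'d)" where
  "rew_xx r x y = fderiv (\<lambda>x'. rew_x r x' y) x"

definition bdry ::
  "(real^'d \<Rightarrow> real^'q \<Rightarrow> real) \<Rightarrow> real^'d \<Rightarrow> real^'q
    \<Rightarrow> 'd phase \<times> 'd phase \<Rightarrow> 'd phase" where
  "bdry r xinf y = (\<lambda>((\<xi>\<^sub>0, \<pi>\<^sub>0), (\<xi>\<^sub>T, \<pi>\<^sub>T)).
     (\<xi>\<^sub>0, \<pi>\<^sub>T - (rew_x r (xinf + \<xi>\<^sub>T) y - rew_x r xinf y)))"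

definition Delta_oc ::
  "(real^'d \<Rightarrow> real^'q \<Rightarrow> real) \<Rightarrow> real^'d \<Rightarrow> real^'d \<Rightarrow> real^'d \<Rightarrow> real^'q \<Rightarrow> 'd phase" where
  "Delta_oc r xinf pinf xin y = (xin - xinf, rew_x r xinf y - pinf)"

definition admissible_data ::
  "(real^'d \<Rightarrow> real^'q \<Rightarrow> real) \<Rightarrow> real^'d \<Rightarrow> real^'d \<Rightarrow> (real^'q) set \<Rightarrow> real \<Rightarrow> ((real^'d) \<times> (real^'q)) set" where
  "admissible_data r xinf pinf Y1 \<delta> = {(xin, y). y \<in> Y1 \<and> norm (Delta_oc r xinf pinf xin y) < \<delta>}"

definition green_kernel :: "real \<Rightarrow> nat \<Rightarrow> nat \<Rightarrow> nat \<Rightarrow> real" where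
  "green_kernel \<gamma> T t s =
     exp (- \<gamma> * \<bar>real t - real s\<bar>) + exp (- \<gamma> * (real t + real T - real s))
       + exp (- \<gamma> * (real T - real t + real s))"

definition linear_bvp ::
  "('a \<times> 'a \<Rightarrow> 'a) \<Rightarrow> ('a \<Rightarrow> 'a) \<Rightarrow> ('a \<Rightarrow> 'a) \<Rightarrow> nat \<Rightarrow> (nat \<Rightarrow> 'a) \<Rightarrow> 'a \<Rightarrow> (nat \<Rightarrow> 'a::real_vector) \<Rightarrow> bool" where
  "linear_bvp L B\<^sub>0 B\<^sub>T T f b h \<longleftrightarrow>
     (\<forall>t<T. L (h t, h (Suc t)) = f t) \<and> B\<^sub>0 (h 0) + B\<^sub>T (h T) = b"

text \<open>Sequences over \<open>{0..T}\<close> are represented by functions on \<open>nat\<close>; to make them unique as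
  objects they are required to lie in \<^term>\<open>extensional {..T}\<close>. The inhomogeneity \<open>f\<close> only
  matters on \<open>{..<T}\<close>.\<close>

definition uniform_green ::
  "('a \<times> 'a \<Rightarrow> 'a::euclidean_space) \<Rightarrow> ('a \<Rightarrow> 'a) \<Rightarrow> ('a \<Rightarrow> 'a) \<Rightarrow> real \<Rightarrow> real \<Rightarrow> nat \<Rightarrow> bool" where
  "uniform_green L B\<^sub>0 B\<^sub>T C \<gamma> T\<^sub>0 \<longleftrightarrow>
     linear L \<and> linear B\<^sub>0 \<and> linear B\<^sub>T \<and> C \<ge> 1 \<and> \<gamma> > 0 \<and> T\<^sub>0 \<ge> 1 \<and>
     (\<forall>T\<ge>T\<^sub>0. \<forall>f b.
        (\<exists>!h. h \<in> extensional {..T} \<and> linear_bvp L B\<^sub>0 B\<^sub>T T f b h) \<and>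
        (\<forall>h. linear_bvp L B\<^sub>0 B\<^sub>T T f b h \<longrightarrow>
           (\<forall>t\<le>T. norm (h t) \<le>
              C * ((exp (- \<gamma> * real t) + exp (- \<gamma> * (real T - real t))) * norm b
                   + (\<Sum>s<T. green_kernel \<gamma> T t s * norm (f s))))))"

definition weight :: "real \<Rightarrow> nat \<Rightarrow> nat \<Rightarrow> real" where
  "weight \<alpha> T t = exp (- \<alpha> * real t) + exp (- \<alpha> * (real T - real t))"

definition wnorm :: "real \<Rightarrow> nat \<Rightarrow> (nat \<Rightarrow> 'a::real_normed_vector) \<Rightarrow> real" where
  "wnorm \<alpha> T z = Max ((\<lambda>t. norm (z t) / weight \<alpha> T t) ` {..T})"

definition stationary_branch ::
  "((real^'d) \<times> (real^'m) \<Rightarrow> real^'d) \<Rightarrow> (real^'d \<Rightarrow> real^'m \<Rightarrow> real^'d \<Rightarrow> real)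
    \<Rightarrow> (real^'d \<Rightarrow> real^'q \<Rightarrow> real) \<Rightarrow> ('d phase \<Rightarrow> real^'m) \<Rightarrow> real^'d \<Rightarrow> real^'d
    \<Rightarrow> real \<Rightarrow> real \<Rightarrow> nat \<Rightarrow> real^'d \<Rightarrow> real^'q \<Rightarrow> (nat \<Rightarrow> 'd phase) \<Rightarrow> bool" where
  "stationary_branch F H r \<nu> xinf pinf \<alpha> R T xin y z \<longleftrightarrow>
     z \<in> extensional {..T} \<and> wnorm \<alpha> T z \<le> R \<and>
     (let x = (\<lambda>t. xinf + fst (z t));
          p = (\<lambda>t. pinf + snd (z t));
          u = (\<lambda>t. \<nu> (x t, p (Suc t)))
      in (\<forall>t<T. x (Suc t) = F (x t, u t) \<and>
                p t = ham_x H (x t) (u t) (p (Suc t)) \<and>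
                ham_u H (x t) (u t) (p (Suc t)) = 0) \<and>
         x 0 = xin \<and> p T = rew_x r (x T) y)"

text \<open>Existence and uniqueness of the branch for small endpoint data is a consequence of the uniform
  Green property and the bounds on the nonlinearity; outside that situation the description below
  is unspecified. The same applies to the linearized branch.\<close>

definition local_branch ::
  "((real^'d) \<times> (real^'m) \<Rightarrow> real^'d) \<Rightarrow> (real^'d \<Rightarrow> real^'m \<Rightarrow> real^'d \<Rightarrow> real)
    \<Rightarrow> (real^'d \<Rightarrow> real^'q \<Rightarrow> real) \<Rightarrow> ('d phase \<Rightarrow> real^'m) \<Rightarrow> real^'d \<Rightarrow> real^'d
    \<Rightarrow> real \<Rightarrow> real \<Rightarrow> nat \<Rightarrow> real^'d \<Rightarrow> real^'q \<Rightarrow> nat \<Rightarrow> 'd phase" where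
  "local_branch F H r \<nu> xinf pinf \<alpha> R T xin y =
     (THE z. stationary_branch F H r \<nu> xinf pinf \<alpha> R T xin y z)"

definition first_control ::
  "((real^'d) \<times> (real^'m) \<Rightarrow> real^'d) \<Rightarrow> (real^'d \<Rightarrow> real^'m \<Rightarrow> real^'d \<Rightarrow> real)
    \<Rightarrow> (real^'d \<Rightarrow> real^'q \<Rightarrow> real) \<Rightarrow> ('d phase \<Rightarrow> real^'m) \<Rightarrow> real^'d \<Rightarrow> real^'d
    \<Rightarrow> real \<Rightarrow> real \<Rightarrow> nat \<Rightarrow> real^'d \<Rightarrow> real^'q \<Rightarrow> real^'m" where
  "first_control F H r \<nu> xinf pinf \<alpha> R T xin y =
     (let z = local_branch F H r \<nu> xinf pinf \<alpha> R T xin y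
      in \<nu> (xinf + fst (z 0), pinf + snd (z 1)))"

definition linear_branch ::
  "('a \<times> 'a \<Rightarrow> 'a) \<Rightarrow> ('a \<times> 'a \<Rightarrow> 'a) \<Rightarrow> nat \<Rightarrow> 'a \<Rightarrow> nat \<Rightarrow> 'a::real_vector" where
  "linear_branch L B T b =
     (THE h. h \<in> extensional {..T} \<and> (\<forall>t<T. L (h t, h (Suc t)) = 0) \<and> B (h 0, h T) = b)"

end

(* Write F~ = L + N. A stationary branch is a solution of the linear boundary value problem for
   (L, DB_{y_inf}) whose data contain -N(z_t, z_{t+1}), the Taylor remainder of r_x(., y) at x_inf and
   the term (r_xx(x_inf, y) - r_xx(x_inf, y_inf)) xi_T. A quadratic nonlinearity is bounded by the square
   of the weight w_T, and the Green kernel maps w_T^2 back into C_conv w_T uniformly in T (this needs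
   alpha < gamma / 2). Hence the solution operator contracts the whole weighted ball of radius R with the
   factor q = theta + (1 - theta) a R < 1. This yields existence and uniqueness of the branch and
   its Lipschitz dependence on the boundary data with the constant C_G / (1 - q). The same estimate, applied
   to the difference of the branch and the linearized branch, leaves only quadratic data. The
   statements for K_T follow since nu is C^2 and the weights at t = 0, 1 are at most 2. *)
theory Submission
  imports Defs
begin

subsection \<open>The Green kernel and the weights\<close>

text \<open>The Green property is available at \<open>yinf\<close> alone, and no Green operator is
  built for any other \<open>y\<close>. Instead, the difference of two sequences is regarded as the
  solution of its own linear problem with the rows at \<open>yinf\<close>, and whatever in its data
  is proportional to that difference is absorbed on the left. This single absorption step gives
  stability, uniqueness and the linearization error. The prescribed \<open>a\<close> and
  \<open>\<delta>\<close> contain \<open>CGbar\<close>, whereas the argument produces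
  \<open>CG\<close>; the link is \<open>CG \<le> (1 - \<theta>) * CGbar\<close>. With it,
  \<open>norm b < \<delta>\<close> gives \<open>CG * norm b \<le> (1 - q) * R\<close>, exactly what
  a self-map of the ball of radius \<open>R\<close> requires. The boundary datum stays a free
  argument, so that dependence on \<open>y\<close> can be reduced to dependence on the datum.
  Existence, stability and the linearization error are proved for every \<open>y\<close> in
  \<open>Y1\<close> with endpoint data of norm below \<open>\<delta>\<close>. The smaller set
  \<open>D\<close> is an open product neighborhood whose second factor lies in one ball, so that a
  local Lipschitz hypothesis in \<open>y\<close> supplies a common constant there.\<close>

definition conv_const :: "real \<Rightarrow> real \<Rightarrow> real" where
  "conv_const \<gamma> \<alpha> = 4 * (1 / (1 - exp (- (\<gamma> - 2 * \<alpha>)))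
     + exp (- (\<gamma> + 2 * \<alpha>)) / (1 - exp (- (\<gamma> + 2 * \<alpha>))))"

lemma geometric_sum_le:
  fixes q :: real
  assumes "0 \<le> q" "q < 1"
  shows "(\<Sum>s<n. q ^ s) \<le> 1 / (1 - q)"
proof -
  have "(\<Sum>s<n. q ^ s) \<le> (\<Sum>s. q ^ s)"
    using assms by (intro sum_le_suminf summable_geometric) auto
  then show ?thesis using suminf_geometric[of q] assms by simp
qed

lemma geometric_sum_Suc_le:
  fixes q :: real
  assumes "0 \<le> q" "q < 1"
  shows "(\<Sum>s<n. q ^ Suc s) \<le> q / (1 - q)"
proof -
  have "(\<Sum>s<n. q ^ Suc s) = q * (\<Sum>s<n. q ^ s)"
    by (simp add: sum_distrib_left)
  also have "\<dots> \<le> q * (1 / (1 - q))"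
    using assms geometric_sum_le by (intro mult_left_mono) auto
  finally show ?thesis by simp
qed

lemma geometric_sum_rev_le:
  fixes q :: real
  assumes "0 \<le> q" "q < 1"
  shows "(\<Sum>s<n. q ^ (n - s)) \<le> q / (1 - q)"
proof -
  have "(\<Sum>s<n. q ^ (n - s)) = (\<Sum>s<n. q ^ Suc s)"
    by (subst sum.nat_diff_reindex[symmetric]) (auto intro!: sum.cong simp: Suc_diff_Suc)
  then show ?thesis using geometric_sum_Suc_le[OF assms] by simp
qed

text \<open>The summand 1 on the right is the term \<open>s = t\<close>; the two fractions bound the
  tails on either side of it.\<close>

lemma two_sided_geometric_sum_le:
  fixes p q :: real
  assumes "0 \<le> p" "p < 1" "0 \<le> q" "q < 1"
  shows "(\<Sum>s<n. if s \<le> t then p ^ (t - s) else q ^ (s - t)) \<le> 1 + p / (1 - p) + q / (1 - q)"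
    (is "sum ?f _ \<le> _")
proof -
  \<comment> \<open>Enlarging the range allows the split at \<open>t\<close> even when
    \<open>n \<le> t\<close>.\<close>
  have "sum ?f {..<n} \<le> sum ?f {..<Suc t + n}"
    using assms by (intro sum_mono2) auto
  also have "\<dots> = sum ?f {..<Suc t} + (\<Sum>i<n. ?f (i + Suc t))"
    by (induction n) (simp_all add: add_ac)
  also have "sum ?f {..<Suc t} = 1 + (\<Sum>s<t. p ^ (t - s))"
    by simp
  also have "(\<Sum>i<n. ?f (i + Suc t)) = (\<Sum>i<n. q ^ Suc i)"
    by (auto intro!: sum.cong)
  finally show ?thesis
    using geometric_sum_rev_le[OF assms(1,2), of t] geometric_sum_Suc_le[OF assms(3,4), of n] by linarith
qed

lemma weight_pos: "weight \<alpha> T t > 0"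
  by (simp add: weight_def add_pos_pos)

lemma weight_le_2: "0 < \<alpha> \<Longrightarrow> t \<le> T \<Longrightarrow> weight \<alpha> T t \<le> 2"
proof -
  assume "0 < \<alpha>" "t \<le> T"
  then have "exp (- \<alpha> * real t) \<le> 1" "exp (- \<alpha> * (real T - real t)) \<le> 1" by auto
  then show ?thesis unfolding weight_def by linarith
qed

lemma weight_Suc_le:
  assumes "0 < \<alpha>"
  shows "weight \<alpha> T (Suc t) \<le> exp \<alpha> * weight \<alpha> T t"
proof -
  have "exp (- \<alpha> * real (Suc t)) \<le> exp \<alpha> * exp (- \<alpha> * real t)"
    unfolding exp_add[symmetric] using assms by (simp add: algebra_simps)
  moreover have "exp (- \<alpha> * (real T - real (Suc t))) = exp \<alpha> * exp (- \<alpha> * (real T - real t))"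
    unfolding exp_add[symmetric] by (simp add: algebra_simps)
  ultimately show ?thesis unfolding weight_def by (simp add: distrib_left)
qed

lemma green_kernel_nonneg: "green_kernel \<gamma> T t s \<ge> 0"
  by (simp add: green_kernel_def)

lemma exp_le_mono_rate: "a \<le> b \<Longrightarrow> 0 \<le> x \<Longrightarrow> exp (- b * x) \<le> exp (- a * x)" for a b x :: real
  by (simp add: mult_right_mono)

text \<open>Up to a factor 2 the squared weight is \<open>e1 + e2\<close>, exponentials of rate
  \<open>2 * \<alpha>\<close> from the two ends. Against the kernel each becomes a geometric series,
  of ratio \<open>qm\<close> where the weight grows while the kernel decays and of ratio
  \<open>qp\<close> where both decay; \<open>2 * \<alpha> < \<gamma>\<close> is what makes
  \<open>qm < 1\<close>. One factor of the weight is lost only in the last estimate, from rate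
  \<open>2 * \<alpha>\<close> to rate \<open>\<alpha>\<close>.\<close>

lemma green_kernel_weight_sum:
  assumes \<alpha>: "0 < \<alpha>" "2 * \<alpha> < \<gamma>" and t: "t \<le> T"
  shows "(\<Sum>s<T. green_kernel \<gamma> T t s * (weight \<alpha> T s)\<^sup>2) \<le> conv_const \<gamma> \<alpha> * weight \<alpha> T t"
proof -
  define qm qp where "qm = exp (- (\<gamma> - 2 * \<alpha>))" and "qp = exp (- (\<gamma> + 2 * \<alpha>))"
  define pm pp where "pm = qm / (1 - qm)" and "pp = qp / (1 - qp)"
  define e1 e2 where "e1 s = exp (- 2 * \<alpha> * real s)" and "e2 s = exp (- 2 * \<alpha> * (real T - real s))" for s :: nat
  define m where "m = exp (- 2 * \<alpha> * real T)"
  have q: "0 \<le> qm" "qm < 1" "0 \<le> qp" "qp < 1"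
    using \<alpha> by (auto simp: qm_def qp_def)
  have p: "0 \<le> pm" "0 \<le> pp" using q by (auto simp: pm_def pp_def)
  have qm_pow: "qm ^ n = exp (- (\<gamma> - 2 * \<alpha>) * real n)" and qp_pow: "qp ^ n = exp (- (\<gamma> + 2 * \<alpha>) * real n)" for n
    by (simp_all add: qm_def qp_def exp_of_nat_mult[symmetric] mult.commute)
  have 1: "(\<Sum>s<T. exp (- \<gamma> * \<bar>real t - real s\<bar>) * e1 s) \<le> e1 t * (1 + pm + pp)"
  proof -
    have "exp (- \<gamma> * \<bar>real t - real s\<bar>) * e1 s = e1 t * (if s \<le> t then qm ^ (t - s) else qp ^ (s - t))" for s
      by (simp add: e1_def qm_pow qp_pow exp_add[symmetric] of_nat_diff algebra_simps)
    then show ?thesis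
      using mult_left_mono[OF two_sided_geometric_sum_le[OF q, where n=T and t=t], of "e1 t"]
      by (simp add: sum_distrib_left[symmetric] pm_def pp_def e1_def)
  qed
  have 2: "(\<Sum>s<T. exp (- \<gamma> * \<bar>real t - real s\<bar>) * e2 s) \<le> e2 t * (1 + pp + pm)"
  proof -
    have "exp (- \<gamma> * \<bar>real t - real s\<bar>) * e2 s = e2 t * (if s \<le> t then qp ^ (t - s) else qm ^ (s - t))" for s
      by (simp add: e2_def qm_pow qp_pow exp_add[symmetric] of_nat_diff algebra_simps)
    then show ?thesis
      using mult_left_mono[OF two_sided_geometric_sum_le[OF q(3,4,1,2), where n=T and t=t], of "e2 t"]
      by (simp add: sum_distrib_left[symmetric] pm_def pp_def e2_def)
  qed
  have m: "0 \<le> m" "m \<le> 1" "m = e1 t * e2 t"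
    using \<alpha> by (auto simp: m_def e1_def e2_def exp_add[symmetric] algebra_simps)
  have e: "0 \<le> e1 t" "e1 t \<le> 1" "0 \<le> e2 t" "e2 t \<le> 1"
    using \<alpha> t by (auto simp: e1_def e2_def mult_nonneg_nonneg)
  have g1: "exp (- \<gamma> * real t) \<le> e1 t" and g2: "exp (- \<gamma> * (real T - real t)) \<le> e2 t"
    unfolding e1_def e2_def using exp_le_mono_rate[of "2 * \<alpha>" \<gamma>] \<alpha> t by auto
  have 3: "(\<Sum>s<T. exp (- \<gamma> * (real t + real T - real s)) * (e1 s + e2 s)) \<le> e1 t * (pm + pp)"
  proof -
    have "exp (- \<gamma> * (real t + real T - real s)) * (e1 s + e2 s)
        = exp (- \<gamma> * real t) * (m * qm ^ (T - s) + qp ^ (T - s))" if "s < T" for s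
      using that by (simp add: e1_def e2_def m_def qm_pow qp_pow exp_add[symmetric] of_nat_diff algebra_simps)
    then have "(\<Sum>s<T. exp (- \<gamma> * (real t + real T - real s)) * (e1 s + e2 s))
        = exp (- \<gamma> * real t) * (m * (\<Sum>s<T. qm ^ (T - s)) + (\<Sum>s<T. qp ^ (T - s)))"
      by (simp add: sum_distrib_left[symmetric] sum.distrib)
    also have "\<dots> \<le> exp (- \<gamma> * real t) * (1 * pm + pp)"
      using m q geometric_sum_rev_le[of qm T] geometric_sum_rev_le[of qp T]
      by (intro mult_left_mono add_mono mult_mono) (auto simp: pm_def pp_def intro!: sum_nonneg)
    also have "\<dots> \<le> e1 t * (pm + pp)"
      using g1 p by (simp add: mult_right_mono)
    finally show ?thesis .
  qed
  have 4: "(\<Sum>s<T. exp (- \<gamma> * (real T - real t + real s)) * (e1 s + e2 s)) \<le> e2 t * (1 + pm + pp) + e1 t"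
  proof -
    have geo: "1 / (1 - q) = 1 + q / (1 - q)" if "q < 1" for q :: real
      using that by (simp add: field_simps)
    have "exp (- \<gamma> * (real T - real t + real s)) * (e1 s + e2 s)
        = exp (- \<gamma> * (real T - real t)) * (qp ^ s + m * qm ^ s)" for s
      by (simp add: e1_def e2_def m_def qm_pow qp_pow exp_add[symmetric] algebra_simps)
    then have "(\<Sum>s<T. exp (- \<gamma> * (real T - real t + real s)) * (e1 s + e2 s))
        = exp (- \<gamma> * (real T - real t)) * ((\<Sum>s<T. qp ^ s) + m * (\<Sum>s<T. qm ^ s))"
      by (simp add: sum_distrib_left[symmetric] sum.distrib)
    also have "\<dots> \<le> e2 t * ((1 + pp) + m * (1 + pm))"
      using m q p geometric_sum_le[of qm T] geometric_sum_le[of qp T] geo[of qm] geo[of qp] g2 e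
      by (intro mult_mono add_mono) (auto simp: pm_def pp_def intro!: sum_nonneg add_nonneg_nonneg mult_nonneg_nonneg)
    \<comment> \<open>Writing \<open>m\<close> as \<open>e1 t * e2 t\<close> charges the term of
      \<open>m\<close> at \<open>s = 0\<close> to \<open>e1\<close>. After adding all four sums,
      \<open>e1\<close> and \<open>e2\<close> then both carry the coefficient
      \<open>2 * (1 + pm + pp)\<close>, which gives the stated constant exactly.\<close>
    also have "\<dots> = e2 t * (1 + pp + m * pm) + e1 t * (e2 t * e2 t)"
      by (simp add: m(3) algebra_simps)
    also have "\<dots> \<le> e2 t * (1 + pp + 1 * pm) + e1 t * (1 * 1)"
      using m p e by (intro add_mono mult_left_mono mult_mono order_refl) auto
    finally show ?thesis by (simp add: algebra_simps)
  qed
  have w2: "(weight \<alpha> T s)\<^sup>2 \<le> 2 * (e1 s + e2 s)" for s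
  proof -
    have "(x + y)\<^sup>2 \<le> 2 * (x\<^sup>2 + y\<^sup>2)" for x y :: real
      using sum_squares_bound[of x y] by (simp add: power2_sum)
    moreover have "e1 s = (exp (- \<alpha> * real s))\<^sup>2" "e2 s = (exp (- \<alpha> * (real T - real s)))\<^sup>2"
      by (simp_all add: e1_def e2_def power2_eq_square exp_add[symmetric])
    ultimately show ?thesis by (simp add: weight_def)
  qed
  have "(\<Sum>s<T. green_kernel \<gamma> T t s * (weight \<alpha> T s)\<^sup>2) \<le> (\<Sum>s<T. green_kernel \<gamma> T t s * (2 * (e1 s + e2 s)))"
    by (intro sum_mono mult_left_mono w2 green_kernel_nonneg)
  also have "\<dots> = 2 * ((\<Sum>s<T. exp (- \<gamma> * \<bar>real t - real s\<bar>) * e1 s)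
      + (\<Sum>s<T. exp (- \<gamma> * \<bar>real t - real s\<bar>) * e2 s)
      + (\<Sum>s<T. exp (- \<gamma> * (real t + real T - real s)) * (e1 s + e2 s))
      + (\<Sum>s<T. exp (- \<gamma> * (real T - real t + real s)) * (e1 s + e2 s)))"
    by (simp add: green_kernel_def sum.distrib[symmetric] sum_distrib_left algebra_simps)
  also have "\<dots> \<le> 2 * (e1 t * (1 + pm + pp) + e2 t * (1 + pp + pm) + e1 t * (pm + pp)
      + (e2 t * (1 + pm + pp) + e1 t))"
    using 1 2 3 4 by (intro mult_left_mono add_mono) auto
  also have "\<dots> = (4 * (1 + pm + pp)) * (e1 t + e2 t)"
    by (simp add: algebra_simps)
  also have "\<dots> \<le> (4 * (1 + pm + pp)) * weight \<alpha> T t"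
    unfolding weight_def e1_def e2_def using p \<alpha> t
    by (intro mult_left_mono add_mono exp_le_mono_rate) auto
  also have "4 * (1 + pm + pp) = conv_const \<gamma> \<alpha>"
    using q unfolding conv_const_def pm_def pp_def qm_def[symmetric] qp_def[symmetric]
    by (simp add: field_simps)
  finally show ?thesis .
qed

subsection \<open>Boundary value problems in the weighted norm\<close>

lemma wnorm_le_iff: "wnorm \<alpha> T z \<le> R \<longleftrightarrow> (\<forall>t\<le>T. norm (z t) \<le> R * weight \<alpha> T t)"
  by (auto simp: wnorm_def pos_divide_le_eq[OF weight_pos])

lemma norm_le_wnorm: "t \<le> T \<Longrightarrow> norm (z t) \<le> wnorm \<alpha> T z * weight \<alpha> T t"
  using wnorm_le_iff[of \<alpha> T z "wnorm \<alpha> T z"] by simp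

lemma wnorm_nonneg: "wnorm \<alpha> T z \<ge> 0"
  using order_trans[OF norm_ge_zero norm_le_wnorm[of 0 T z \<alpha>]] weight_pos[of \<alpha> T 0]
  by (simp add: zero_le_mult_iff)

lemma norm_le_2_wnorm:
  assumes "0 < \<alpha>" "t \<le> T"
  shows "norm (z t) \<le> 2 * wnorm \<alpha> T z"
  using norm_le_wnorm[of t T z \<alpha>] mult_left_mono[OF weight_le_2[OF assms] wnorm_nonneg[of \<alpha> T z]] assms
  by (simp add: mult.commute)

lemma wnorm_diff_le_0_imp_eq: "wnorm \<alpha> T (\<lambda>t. z t - z' t) \<le> 0 \<Longrightarrow> t \<le> T \<Longrightarrow> z t = z' t"
  by (simp add: wnorm_le_iff)

text \<open>A residual couples the times \<open>t\<close> and \<open>t + 1\<close>, and moving the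
  weight by one step costs at most \<open>exp \<alpha>\<close>. This is the origin of the factor
  \<open>1 + exp \<alpha>\<close>, squared in a quadratic estimate.\<close>

lemma norm_add_Suc_le_wnorm:
  assumes "0 < \<alpha>" "t < T"
  shows "norm (z t) + norm (z (Suc t)) \<le> wnorm \<alpha> T z * ((1 + exp \<alpha>) * weight \<alpha> T t)"
proof -
  have "norm (z t) + norm (z (Suc t)) \<le> wnorm \<alpha> T z * weight \<alpha> T t + wnorm \<alpha> T z * weight \<alpha> T (Suc t)"
    using assms by (intro add_mono norm_le_wnorm) auto
  also have "\<dots> \<le> wnorm \<alpha> T z * weight \<alpha> T t + wnorm \<alpha> T z * (exp \<alpha> * weight \<alpha> T t)"
    using assms by (intro add_mono mult_left_mono weight_Suc_le wnorm_nonneg order_refl)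
  finally show ?thesis by (simp add: algebra_simps)
qed

text \<open>The library instance of \<^class>\<open>complete_space\<close> for bounded continuous functions asks for a
  metric domain, which \<^typ>\<open>nat\<close> is not.\<close>

lemma complete_UNIV_bcontfun: "complete (UNIV :: ('a::topological_space \<Rightarrow>\<^sub>C 'b::complete_space) set)"
  unfolding complete_def
proof (intro allI impI)
  fix f :: "nat \<Rightarrow> 'a \<Rightarrow>\<^sub>C 'b"
  assume "(\<forall>n. f n \<in> UNIV) \<and> Cauchy f"
  then have "Cauchy f" by simp
  then have "uniformly_Cauchy_on UNIV (\<lambda>n. apply_bcontfun (f n))"
    unfolding uniformly_Cauchy_on_def Cauchy_def by (meson dist_bounded le_less_trans)
  then obtain g where "uniform_limit UNIV (\<lambda>n. apply_bcontfun (f n)) g sequentially"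
    using Cauchy_uniformly_convergent unfolding uniformly_convergent_on_def by blast
  from uniform_limit_bcontfunE[OF this sequentially_bot]
  show "\<exists>l\<in>UNIV. f \<longlonglongrightarrow> l" by (metis UNIV_I)
qed

locale weighted_green =
  fixes L :: "'a \<times> 'a \<Rightarrow> 'a::euclidean_space" and B\<^sub>0 B\<^sub>T :: "'a \<Rightarrow> 'a" and C \<gamma> \<alpha> :: real and T\<^sub>0 :: nat
  assumes green: "uniform_green L B\<^sub>0 B\<^sub>T C \<gamma> T\<^sub>0" and \<alpha>: "0 < \<alpha>" "2 * \<alpha> < \<gamma>"
begin

lemma linear: "linear L" "linear B\<^sub>0" "linear B\<^sub>T" and C_ge_1: "C \<ge> 1" and T\<^sub>0_ge_1: "T\<^sub>0 \<ge> 1"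
  using green by (auto simp: uniform_green_def)

text \<open>The sequence \<open>d\<close> solves the linear problem whose data are its own defects,
  so the Green estimate applies to it directly. Defects are measured against the squared weight
  because they will come from products of two decaying sequences.\<close>

lemma wnorm_le:
  assumes "T \<ge> T\<^sub>0"
    and defect: "\<And>s. s < T \<Longrightarrow> norm (L (d s, d (Suc s))) \<le> \<phi> * (weight \<alpha> T s)\<^sup>2"
    and bdry: "norm (B\<^sub>0 (d 0) + B\<^sub>T (d T)) \<le> \<beta>"
  shows "wnorm \<alpha> T d \<le> C * (\<beta> + conv_const \<gamma> \<alpha> * \<phi>)"
  unfolding wnorm_le_iff
proof (intro allI impI)
  fix t assume t: "t \<le> T"
  define f where "f s = L (d s, d (Suc s))" for s
  define b where "b = B\<^sub>0 (d 0) + B\<^sub>T (d T)"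
  \<comment> \<open>As \<open>s = 0\<close> is an admissible index, the defect bound itself forces
    \<open>\<phi>\<close> to be nonnegative, so no sign condition is imposed on it.\<close>
  have "0 < T" using assms(1) T\<^sub>0_ge_1 by simp
  then have "0 \<le> \<phi> * (weight \<alpha> T 0)\<^sup>2"
    using defect[of 0] order_trans[OF norm_ge_zero] by blast
  then have \<phi>: "0 \<le> \<phi>" using weight_pos[of \<alpha> T 0] by (simp add: zero_le_mult_iff)
  have \<beta>: "0 \<le> \<beta>" using bdry norm_ge_zero order_trans by blast
  have "linear_bvp L B\<^sub>0 B\<^sub>T T f b d"
    by (simp add: linear_bvp_def f_def b_def)
  then have "norm (d t) \<le> C * ((exp (- \<gamma> * real t) + exp (- \<gamma> * (real T - real t))) * norm b
                   + (\<Sum>s<T. green_kernel \<gamma> T t s * norm (f s)))"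
    using green assms(1) t unfolding uniform_green_def by blast
  also have "\<dots> \<le> C * (weight \<alpha> T t * \<beta> + conv_const \<gamma> \<alpha> * weight \<alpha> T t * \<phi>)"
  proof (intro mult_left_mono add_mono)
    show "(exp (- \<gamma> * real t) + exp (- \<gamma> * (real T - real t))) * norm b \<le> weight \<alpha> T t * \<beta>"
      unfolding weight_def b_def using \<alpha> t bdry
      by (intro mult_mono add_mono exp_le_mono_rate) auto
    have "(\<Sum>s<T. green_kernel \<gamma> T t s * norm (f s)) \<le> (\<Sum>s<T. green_kernel \<gamma> T t s * (\<phi> * (weight \<alpha> T s)\<^sup>2))"
      unfolding f_def using defect by (intro sum_mono mult_left_mono green_kernel_nonneg) auto
    also have "\<dots> = (\<Sum>s<T. green_kernel \<gamma> T t s * (weight \<alpha> T s)\<^sup>2) * \<phi>"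
      by (simp add: sum_distrib_left mult_ac)
    also have "\<dots> \<le> conv_const \<gamma> \<alpha> * weight \<alpha> T t * \<phi>"
      using \<alpha> t \<phi> by (intro mult_right_mono green_kernel_weight_sum)
    finally show "(\<Sum>s<T. green_kernel \<gamma> T t s * norm (f s)) \<le> conv_const \<gamma> \<alpha> * weight \<alpha> T t * \<phi>" .
  qed (use C_ge_1 in simp)
  finally show "norm (d t) \<le> C * (\<beta> + conv_const \<gamma> \<alpha> * \<phi>) * weight \<alpha> T t"
    by (simp add: algebra_simps)
qed

text \<open>An a priori estimate by absorption: the data bounds may contain the unknown
  \<open>wnorm \<alpha> T d\<close>, whose total coefficient is at most \<open>q < 1\<close> and is
  moved to the left. In the applications \<open>\<kappa>\<close> carries the change of the boundary
  rows with \<open>y\<close>, so that the Green property at one parameter suffices.\<close>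

lemma wnorm_le_perturbed:
  assumes "T \<ge> T\<^sub>0"
    and "\<And>s. s < T \<Longrightarrow> norm (L (d s, d (Suc s))) \<le> (\<phi> + \<psi> * wnorm \<alpha> T d) * (weight \<alpha> T s)\<^sup>2"
    and "norm (B\<^sub>0 (d 0) + B\<^sub>T (d T)) \<le> \<beta> + \<kappa> * wnorm \<alpha> T d"
    and q: "C * (\<kappa> + conv_const \<gamma> \<alpha> * \<psi>) \<le> q" "q < 1"
  shows "wnorm \<alpha> T d \<le> C * (\<beta> + conv_const \<gamma> \<alpha> * \<phi>) / (1 - q)"
proof -
  have "wnorm \<alpha> T d \<le> C * (\<beta> + \<kappa> * wnorm \<alpha> T d + conv_const \<gamma> \<alpha> * (\<phi> + \<psi> * wnorm \<alpha> T d))"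
    by (rule wnorm_le[OF assms(1-3)])
  also have "\<dots> = C * (\<beta> + conv_const \<gamma> \<alpha> * \<phi>) + C * (\<kappa> + conv_const \<gamma> \<alpha> * \<psi>) * wnorm \<alpha> T d"
    by (simp add: algebra_simps)
  also have "\<dots> \<le> C * (\<beta> + conv_const \<gamma> \<alpha> * \<phi>) + q * wnorm \<alpha> T d"
    using q by (intro add_left_mono mult_right_mono wnorm_nonneg)
  finally show ?thesis
    using q by (simp add: pos_le_divide_eq algebra_simps)
qed

text \<open>Banach's fixed point theorem for the map that freezes the right-hand sides at
  \<open>z\<close> and solves the linear problem. Since \<open>g\<close> and \<open>k\<close> vanish
  at 0, comparison with the zero sequence turns the Lipschitz bounds into size bounds and yields the
  self-map.\<close>

lemma semilinear_bvp_solvable: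
  fixes g :: "'a \<Rightarrow> 'a \<Rightarrow> 'a" and k :: "'a \<Rightarrow> 'a"
  assumes T: "T \<ge> T\<^sub>0" and R: "0 \<le> R"
    and g: "\<And>z z' s. wnorm \<alpha> T z \<le> R \<Longrightarrow> wnorm \<alpha> T z' \<le> R \<Longrightarrow> s < T \<Longrightarrow>
      norm (g (z s) (z (Suc s)) - g (z' s) (z' (Suc s))) \<le> \<psi> * wnorm \<alpha> T (\<lambda>t. z t - z' t) * (weight \<alpha> T s)\<^sup>2"
    and k: "\<And>z z'. wnorm \<alpha> T z \<le> R \<Longrightarrow> wnorm \<alpha> T z' \<le> R \<Longrightarrow>
      norm (k (z T) - k (z' T)) \<le> \<kappa> * wnorm \<alpha> T (\<lambda>t. z t - z' t)"
    and zero: "g 0 0 = 0" "k 0 = 0" and nonneg: "0 \<le> \<psi>" "0 \<le> \<kappa>"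
    and q: "C * (\<kappa> + conv_const \<gamma> \<alpha> * \<psi>) \<le> q" "0 \<le> q" "q < 1" and b: "C * norm b + q * R \<le> R"
  shows "\<exists>z\<in>extensional {..T}. wnorm \<alpha> T z \<le> R \<and> (\<forall>t<T. L (z t, z (Suc t)) = g (z t) (z (Suc t)))
    \<and> B\<^sub>0 (z 0) + B\<^sub>T (z T) = b + k (z T)"
proof -
  \<comment> \<open>Any solution will do: the Green estimate holds for each of them, and values
    beyond \<open>T\<close> never enter.\<close>
  define sol where "sol z = (SOME h. linear_bvp L B\<^sub>0 B\<^sub>T T (\<lambda>t. g (z t) (z (Suc t))) (b + k (z T)) h)" for z
  have sol: "linear_bvp L B\<^sub>0 B\<^sub>T T (\<lambda>t. g (z t) (z (Suc t))) (b + k (z T)) (sol z)" for z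
  proof -
    have "\<exists>h. linear_bvp L B\<^sub>0 B\<^sub>T T (\<lambda>t. g (z t) (z (Suc t))) (b + k (z T)) h"
      using green T unfolding uniform_green_def by blast
    then show ?thesis unfolding sol_def by (rule someI_ex)
  qed
  have sol_bound: "wnorm \<alpha> T (sol z) \<le> R" if z: "wnorm \<alpha> T z \<le> R" for z
  proof -
    have 0: "wnorm \<alpha> T (\<lambda>_. 0 :: 'a) \<le> R"
      using R weight_pos[of \<alpha> T] by (simp add: wnorm_le_iff less_imp_le)
    have "wnorm \<alpha> T (sol z) \<le> C * (norm b + \<kappa> * wnorm \<alpha> T z + conv_const \<gamma> \<alpha> * (\<psi> * wnorm \<alpha> T z))"
    proof (rule wnorm_le[OF T])
      show "norm (L (sol z s, sol z (Suc s))) \<le> \<psi> * wnorm \<alpha> T z * (weight \<alpha> T s)\<^sup>2" if "s < T" for s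
        using sol[of z] g[OF z 0 that] that zero by (simp add: linear_bvp_def)
      show "norm (B\<^sub>0 (sol z 0) + B\<^sub>T (sol z T)) \<le> norm b + \<kappa> * wnorm \<alpha> T z"
        using sol[of z] k[OF z 0] zero norm_triangle_ineq[of b "k (z T)"] by (simp add: linear_bvp_def)
    qed
    also have "\<dots> = C * norm b + C * (\<kappa> + conv_const \<gamma> \<alpha> * \<psi>) * wnorm \<alpha> T z"
      by (simp add: algebra_simps)
    also have "\<dots> \<le> C * norm b + q * R"
      using q z by (intro add_left_mono mult_mono wnorm_nonneg) auto
    finally show ?thesis using b by simp
  qed
  have sol_contraction: "wnorm \<alpha> T (\<lambda>t. sol z t - sol z' t) \<le> q * wnorm \<alpha> T (\<lambda>t. z t - z' t)"
    if z: "wnorm \<alpha> T z \<le> R" "wnorm \<alpha> T z' \<le> R" for z z'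
  proof -
    let ?d = "wnorm \<alpha> T (\<lambda>t. z t - z' t)"
    have "wnorm \<alpha> T (\<lambda>t. sol z t - sol z' t) \<le> C * (\<kappa> * ?d + conv_const \<gamma> \<alpha> * (\<psi> * ?d))"
    proof (rule wnorm_le[OF T])
      show "norm (L (sol z s - sol z' s, sol z (Suc s) - sol z' (Suc s))) \<le> \<psi> * ?d * (weight \<alpha> T s)\<^sup>2"
        if "s < T" for s
      proof -
        have "L (sol z s - sol z' s, sol z (Suc s) - sol z' (Suc s))
            = L (sol z s, sol z (Suc s)) - L (sol z' s, sol z' (Suc s))"
          using linear_diff[OF linear(1), of "(sol z s, sol z (Suc s))" "(sol z' s, sol z' (Suc s))"] by simp
        then show ?thesis using sol[of z] sol[of z'] g[OF z that] that by (simp add: linear_bvp_def)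
      qed
      have "B\<^sub>0 (sol z 0 - sol z' 0) + B\<^sub>T (sol z T - sol z' T)
          = (B\<^sub>0 (sol z 0) + B\<^sub>T (sol z T)) - (B\<^sub>0 (sol z' 0) + B\<^sub>T (sol z' T))"
        using linear by (simp add: linear_diff)
      then show "norm (B\<^sub>0 (sol z 0 - sol z' 0) + B\<^sub>T (sol z T - sol z' T)) \<le> \<kappa> * ?d"
        using sol[of z] sol[of z'] k[OF z] by (simp add: linear_bvp_def)
    qed
    also have "\<dots> = C * (\<kappa> + conv_const \<gamma> \<alpha> * \<psi>) * ?d"
      by (simp add: algebra_simps)
    also have "\<dots> \<le> q * ?d" using q by (intro mult_right_mono wnorm_nonneg) auto
    finally show ?thesis .
  qed
  \<comment> \<open>Division by the weight carries the weighted ball to a ball in the complete space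
    of bounded continuous functions on \<open>nat\<close>. Setting \<open>scale\<close> to 0 beyond
    \<open>T\<close> makes its sup norm depend on \<open>{..T}\<close> only, like
    \<open>wnorm\<close>.\<close>
  define unscale where "unscale v t = weight \<alpha> T t *\<^sub>R apply_bcontfun v t" for v :: "nat \<Rightarrow>\<^sub>C 'a" and t
  define scale where "scale z t = (if t \<le> T then z t /\<^sub>R weight \<alpha> T t else 0)" for z :: "nat \<Rightarrow> 'a" and t
  have scale_le: "norm (scale z t) \<le> wnorm \<alpha> T z" for z t
    using norm_le_wnorm[of t T z \<alpha>] weight_pos[of \<alpha> T t] wnorm_nonneg[of \<alpha> T z]
    by (simp add: scale_def divide_simps mult.commute)
  have scale_bcontfun: "apply_bcontfun (Bcontfun (scale z)) = scale z" for z
    using scale_le by (intro Bcontfun_inverse bcontfun_normI) auto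
  have unscale_le: "wnorm \<alpha> T (\<lambda>t. unscale v t - unscale v' t) \<le> dist v v'" for v v'
    unfolding wnorm_le_iff
  proof (intro allI impI)
    fix t
    have "norm (unscale v t - unscale v' t) = weight \<alpha> T t * dist (apply_bcontfun v t) (apply_bcontfun v' t)"
      using weight_pos[of \<alpha> T t] by (simp add: unscale_def scaleR_diff_right[symmetric] dist_norm)
    then show "norm (unscale v t - unscale v' t) \<le> dist v v' * weight \<alpha> T t"
      using weight_pos[of \<alpha> T t] dist_bounded[of v t v'] by (simp add: mult.commute)
  qed
  define \<Phi> where "\<Phi> v = Bcontfun (scale (sol (unscale v)))" for v
  have ball: "wnorm \<alpha> T (unscale v) \<le> R" if "v \<in> cball 0 R" for v
  proof -
    have "unscale 0 = (\<lambda>t. 0)" by (simp add: unscale_def fun_eq_iff)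
    then show ?thesis using unscale_le[of v 0] that by (simp add: dist_commute)
  qed
  have "\<exists>!v\<in>cball 0 R. \<Phi> v = v"
  proof (rule Banach_fix[where c = q])
    show "complete (cball (0 :: nat \<Rightarrow>\<^sub>C 'a) R)"
      using complete_UNIV_bcontfun complete_closed_subset closed_cball by blast
    show "cball (0 :: nat \<Rightarrow>\<^sub>C 'a) R \<noteq> {}" using R by simp
    show "\<Phi> ` cball 0 R \<subseteq> cball 0 R"
    proof (intro image_subsetI)
      fix v assume v: "v \<in> cball (0 :: nat \<Rightarrow>\<^sub>C 'a) R"
      have "norm (\<Phi> v) \<le> R"
      proof (rule norm_bound)
        show "norm (apply_bcontfun (\<Phi> v) t) \<le> R" for t
          unfolding \<Phi>_def scale_bcontfun
          using scale_le[of "sol (unscale v)" t] sol_bound[OF ball[OF v]] by linarith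
      qed
      then show "\<Phi> v \<in> cball 0 R" by simp
    qed
    show "dist (\<Phi> v) (\<Phi> v') \<le> q * dist v v'" if v: "v \<in> cball 0 R" "v' \<in> cball 0 R" for v v'
    proof (rule dist_bound)
      fix t
      let ?h = "sol (unscale v)" and ?h' = "sol (unscale v')"
      have "dist (apply_bcontfun (\<Phi> v) t) (apply_bcontfun (\<Phi> v') t) = norm (scale (\<lambda>t. ?h t - ?h' t) t)"
        unfolding \<Phi>_def scale_bcontfun by (simp add: scale_def dist_norm scaleR_diff_right)
      also have "\<dots> \<le> q * wnorm \<alpha> T (\<lambda>t. unscale v t - unscale v' t)"
        using scale_le sol_contraction[OF ball[OF v(1)] ball[OF v(2)]] by (rule order_trans)
      also have "\<dots> \<le> q * dist v v'"
        using q by (intro mult_left_mono unscale_le)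
      finally show "dist (apply_bcontfun (\<Phi> v) t) (apply_bcontfun (\<Phi> v') t) \<le> q * dist v v'" .
    qed
  qed (use q in auto)
  then obtain v where v: "v \<in> cball 0 R" "\<Phi> v = v" by blast
  define z where "z = restrict (unscale v) {..T}"
  have z: "z t = unscale v t" if "t \<le> T" for t using that by (simp add: z_def)
  have sol_z: "sol (unscale v) t = z t" if "t \<le> T" for t
  proof -
    have "apply_bcontfun v t = sol (unscale v) t /\<^sub>R weight \<alpha> T t"
      using scale_bcontfun[of "sol (unscale v)"] v(2) that by (simp add: \<Phi>_def scale_def)
    then show ?thesis using that weight_pos[of \<alpha> T t] by (simp add: z unscale_def)
  qed
  have "wnorm \<alpha> T z \<le> R"
    using ball[OF v(1)] by (simp add: wnorm_le_iff z)
  moreover have "z \<in> extensional {..T}" by (simp add: z_def)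
  moreover have "\<forall>t<T. L (z t, z (Suc t)) = g (z t) (z (Suc t))" "B\<^sub>0 (z 0) + B\<^sub>T (z T) = b + k (z T)"
    using sol[of "unscale v"] by (simp_all add: linear_bvp_def sol_z z[symmetric] Suc_leI)
  ultimately show ?thesis by blast
qed

end

subsection \<open>Taylor remainders of gradients\<close>

lemma has_derivative_fderiv:
  "f differentiable (at x) \<Longrightarrow> (f has_derivative blinfun_apply (fderiv f x)) (at x)"
  unfolding fderiv_def
  by (simp add: bounded_linear_Blinfun_apply frechet_derivative_works has_derivative_bounded_linear)

lemma fderiv_apply:
  assumes "(f has_derivative f') (at x)"
  shows "blinfun_apply (fderiv f x) v = f' v"
  using has_derivative_fderiv[of f x] has_derivative_unique[OF assms] assms
  by (metis differentiableI)

lemma has_derivative_fderiv_shift: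
  assumes "g differentiable (at (x0 + v))"
  shows "((\<lambda>v. g (x0 + v)) has_derivative blinfun_apply (fderiv g (x0 + v))) (at v within A)"
proof -
  have "((\<lambda>v. x0 + v) has_derivative (\<lambda>h. h)) (at v within A)"
    by (auto intro!: derivative_eq_intros)
  moreover have "(g has_derivative blinfun_apply (fderiv g (x0 + v))) (at (x0 + v) within (\<lambda>v. x0 + v) ` A)"
    using has_derivative_fderiv[OF assms] by (rule has_derivative_at_withinI)
  ultimately show ?thesis using diff_chain_within[of "\<lambda>v. x0 + v" _ v A g] by (simp add: o_def)
qed

text \<open>The mean value inequality is used twice: for \<open>fderiv f\<close>, which stays within
  \<open>M * norm v\<close> of its value at \<open>x0\<close>, and then for \<open>f\<close> minus
  its linear part on \<open>S \<inter> cball 0 s\<close>. With two free points the same bound yields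
  a Lipschitz constant proportional to \<open>s\<close> and, for \<open>v2 = 0\<close>, a quadratic
  remainder.\<close>

lemma derivative_remainder_bound:
  fixes f :: "'a::real_normed_vector \<Rightarrow> 'b::real_normed_vector"
  assumes S: "convex S" "0 \<in> S"
    and f: "\<And>v. v \<in> S \<Longrightarrow> f differentiable (at (x0 + v))"
    and f': "\<And>v. v \<in> S \<Longrightarrow> fderiv f differentiable (at (x0 + v))"
    and M: "\<And>v. v \<in> S \<Longrightarrow> norm (fderiv (fderiv f) (x0 + v)) \<le> M"
    and v: "v1 \<in> S" "v2 \<in> S" "norm v1 \<le> s" "norm v2 \<le> s"
  shows "norm (f (x0 + v1) - f (x0 + v2) - fderiv f x0 (v1 - v2)) \<le> M * s * norm (v1 - v2)"
proof -
  have M0: "0 \<le> M" using M[OF S(2)] norm_ge_zero order_trans by blast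
  have f'_bound: "norm (fderiv f (x0 + v) - fderiv f x0) \<le> M * norm v" if "v \<in> S" for v
  proof -
    have "norm (fderiv f (x0 + v) - fderiv f (x0 + 0)) \<le> M * norm (v - 0)"
      by (rule differentiable_bound[OF S(1), where f' = "\<lambda>v. blinfun_apply (fderiv (fderiv f) (x0 + v))"])
        (use that S M f' in \<open>auto simp: norm_blinfun.rep_eq[symmetric] intro!: has_derivative_fderiv_shift\<close>)
    then show ?thesis by simp
  qed
  define h where "h v = f (x0 + v) - fderiv f x0 v" for v
  have "norm (h v1 - h v2) \<le> M * s * norm (v1 - v2)"
  proof (rule differentiable_bound[where S = "S \<inter> cball 0 s" and f' = "\<lambda>v. blinfun_apply (fderiv f (x0 + v) - fderiv f x0)"])
    show "(h has_derivative blinfun_apply (fderiv f (x0 + v) - fderiv f x0)) (at v within S \<inter> cball 0 s)"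
      if "v \<in> S \<inter> cball 0 s" for v
      unfolding h_def minus_blinfun.rep_eq
      using that by (intro has_derivative_diff has_derivative_fderiv_shift f bounded_linear_imp_has_derivative blinfun.bounded_linear_right) auto
    show "onorm (blinfun_apply (fderiv f (x0 + v) - fderiv f x0)) \<le> M * s" if "v \<in> S \<inter> cball 0 s" for v
    proof -
      have "M * norm v \<le> M * s" using that M0 by (intro mult_left_mono) auto
      then show ?thesis using f'_bound[of v] that by (simp add: norm_blinfun.rep_eq[symmetric])
    qed
  qed (use S v in \<open>auto intro: convex_Int\<close>)
  then show ?thesis by (simp add: h_def blinfun.diff_right algebra_simps)
qed

text \<open>The bridge between the coordinatewise \<open>grad\<close> and the nested
  \<open>fderiv\<close>: a linear map of norm at most 1, through which bounds on derivatives of the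
  reward pass to \<open>rew_x\<close> and \<open>rew_xx\<close> without a dimension
  constant.\<close>

definition riesz :: "(real^'n) \<Rightarrow>\<^sub>L real \<Rightarrow> real^'n" where
  "riesz A = (\<chi> i. blinfun_apply A (axis i 1))"

lemma inner_riesz: "riesz A \<bullet> v = blinfun_apply A v"
proof -
  have "blinfun_apply A v = blinfun_apply A (\<Sum>i\<in>UNIV. v $ i *s axis i 1)"
    by (simp add: basis_expansion)
  also have "\<dots> = (\<Sum>i\<in>UNIV. v $ i * blinfun_apply A (axis i 1))"
    by (simp add: blinfun.sum_right blinfun.scaleR_right scalar_mult_eq_scaleR)
  finally show ?thesis by (simp add: riesz_def inner_vec_def mult.commute)
qed

lemma norm_riesz_le: "norm (riesz A) \<le> norm A"
proof -
  have "norm (riesz A) * norm (riesz A) = blinfun_apply A (riesz A)"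
    by (simp add: inner_riesz[symmetric] dot_square_norm power2_eq_square)
  also have "\<dots> \<le> norm A * norm (riesz A)"
    using norm_blinfun[of A "riesz A"] by simp
  finally show ?thesis
    by (cases "riesz A = 0") simp_all
qed

lemma riesz_diff: "riesz (A - B) = riesz A - riesz B"
  by (simp add: riesz_def vec_eq_iff blinfun.diff_left)

lemma bounded_linear_riesz: "bounded_linear riesz"
  by (rule bounded_linear_intro[where K = 1])
    (auto simp: riesz_def vec_eq_iff blinfun.add_left blinfun.scaleR_left norm_riesz_le[unfolded riesz_def])

lemma grad_eq_riesz: "f differentiable (at x) \<Longrightarrow> grad f x = riesz (fderiv f x)"
  unfolding grad_def riesz_def fderiv_def
  by (simp add: bounded_linear_Blinfun_apply frechet_derivative_works has_derivative_bounded_linear)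

text \<open>\<open>grad\<close> is identified with \<open>riesz\<close> of \<open>fderiv\<close> at
  points of differentiability, hence the passage through an open set around
  \<open>x\<close>.\<close>

lemma grad_has_derivative:
  assumes "open X" "x \<in> X" and f: "C3_on f X"
  shows "(grad f has_derivative (\<lambda>h. riesz (fderiv (fderiv f) x h))) (at x)"
proof -
  have "((\<lambda>x. riesz (fderiv f x)) has_derivative (\<lambda>h. riesz (fderiv (fderiv f) x h))) (at x)"
    using f assms(2) has_derivative_fderiv[of "fderiv f" x]
    by (intro bounded_linear.has_derivative[OF bounded_linear_riesz])
      (auto simp: C3_on_def C2_on_def C1_on_def)
  then show ?thesis
    by (rule has_derivative_transform_within_open[OF _ assms(1,2)])
      (use f in \<open>auto simp: C3_on_def C1_on_def grad_eq_riesz\<close>)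
qed

lemma norm_fderiv_grad_le:
  assumes "open X" "x \<in> X" "C3_on f X"
  shows "norm (fderiv (grad f) x) \<le> norm (fderiv (fderiv f) x)"
proof (rule norm_blinfun_bound)
  show "norm (fderiv (grad f) x h) \<le> norm (fderiv (fderiv f) x) * norm h" for h
    unfolding fderiv_apply[OF grad_has_derivative[OF assms]]
    by (rule order_trans[OF norm_riesz_le norm_blinfun])
qed simp

lemma grad_remainder_bound:
  assumes X: "open X" "(\<lambda>v. x0 + v) ` S \<subseteq> X" and f: "C3_on f X"
    and S: "convex S" "0 \<in> S"
    and M: "\<And>v. v \<in> S \<Longrightarrow> norm (fderiv (fderiv (fderiv f)) (x0 + v)) \<le> M"
    and v: "v1 \<in> S" "v2 \<in> S" "norm v1 \<le> s" "norm v2 \<le> s"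
  shows "norm (grad f (x0 + v1) - grad f (x0 + v2) - fderiv (grad f) x0 (v1 - v2)) \<le> M * s * norm (v1 - v2)"
proof -
  have SX: "x0 + v \<in> X" if "v \<in> S" for v using X that by blast
  have "x0 \<in> X" using SX[OF S(2)] by simp
  then have "grad f (x0 + v1) - grad f (x0 + v2) - fderiv (grad f) x0 (v1 - v2)
      = riesz (fderiv f (x0 + v1) - fderiv f (x0 + v2) - fderiv (fderiv f) x0 (v1 - v2))"
    using f SX[OF v(1)] SX[OF v(2)] fderiv_apply[OF grad_has_derivative[OF X(1) _ f]]
    by (simp add: riesz_diff grad_eq_riesz C3_on_def C1_on_def)
  also have "norm \<dots> \<le> norm (fderiv f (x0 + v1) - fderiv f (x0 + v2) - fderiv (fderiv f) x0 (v1 - v2))"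
    by (rule norm_riesz_le)
  also have "\<dots> \<le> M * s * norm (v1 - v2)"
    using f SX by (intro derivative_remainder_bound[OF S _ _ M v]) (auto simp: C3_on_def C2_on_def C1_on_def)
  finally show ?thesis .
qed

text \<open>Exhibits \<open>rew_xx\<close> as the only place where \<open>y\<close> enters the
  linearized rows; the distance between the rows at \<open>y\<close> and at \<open>yinf\<close> is
  therefore what \<open>\<theta>\<close> controls.\<close>

lemma fderiv_bdry:
  assumes "(\<lambda>x. rew_x r x y) differentiable (at xinf)"
  shows "fderiv (bdry r xinf y) (0, 0) (h0, hT) = (fst h0, snd hT - rew_xx r xinf y (fst hT))"
proof -
  have eq: "bdry r xinf y = (\<lambda>h. (fst (fst h), snd (snd h) - (rew_x r (xinf + fst (snd h)) y - rew_x r xinf y)))"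
    by (auto simp: bdry_def split_beta)
  have "((\<lambda>x. rew_x r x y) has_derivative rew_xx r xinf y) (at (xinf + fst (snd (0, 0))))"
    using has_derivative_fderiv[OF assms] by (simp add: rew_xx_def)
  then have "((\<lambda>h. rew_x r (xinf + fst (snd h)) y) has_derivative (\<lambda>h. rew_xx r xinf y (fst (snd h)))) (at (0, 0))"
    by (rule has_derivative_compose[rotated]) (auto intro!: derivative_eq_intros)
  then have "(bdry r xinf y has_derivative (\<lambda>h. (fst (fst h), snd (snd h) - (rew_xx r xinf y (fst (snd h)) - 0)))) (at (0, 0))"
    unfolding eq by (intro has_derivative_Pair has_derivative_diff has_derivative_const has_derivative_fst has_derivative_snd has_derivative_ident)
  then show ?thesis by (simp add: fderiv_apply)
qed

subsection \<open>The first control\<close>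

theorem corollary5p3:
  fixes U V U0 :: "(real^'m) set"
    and Y Y0 Y1 :: "(real^'q) set"
    and W :: "((real^'d) \<times> (real^'m)) set"
    and \<Omega> :: "'d phase set"
    and Zx Zp Bx Bp :: "(real^'d) set"
    and F :: "(real^'d) \<times> (real^'m) \<Rightarrow> real^'d"
    and l :: "(real^'d) \<times> (real^'m) \<Rightarrow> real"
    and r :: "real^'d \<Rightarrow> real^'q \<Rightarrow> real"
    and H :: "real^'d \<Rightarrow> real^'m \<Rightarrow> real^'d \<Rightarrow> real"
    and \<nu> :: "'d phase \<Rightarrow> real^'m"
    and Ft :: "'d phase \<times> 'd phase \<Rightarrow> 'd phase"
    and L :: "('d phase \<times> 'd phase) \<Rightarrow>\<^sub>L 'd phase"
    and DB :: "real^'q \<Rightarrow> ('d phase \<times> 'd phase) \<Rightarrow>\<^sub>L 'd phase"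
    and N :: "'d phase \<Rightarrow> 'd phase \<Rightarrow> 'd phase"
    and \<Delta> :: "real^'d \<Rightarrow> real^'q \<Rightarrow> 'd phase"
    and K :: "nat \<Rightarrow> real^'d \<Rightarrow> real^'q \<Rightarrow> real^'m"
    and xinf pinf :: "real^'d" and uinf :: "real^'m" and yinf :: "real^'q"
    and lam Mint Mter CG CGbar \<gamma> \<alpha> \<theta> CN Cconv qm qp a c R \<delta> \<rho>x \<rho>p :: real
    and T0 :: nat
  \<comment> \<open>setting and reference point\<close>
  assumes "compact U" and "convex U" and "open Y" and "lam > 0"
    and "H = hamiltonian lam F l"
    and "xinf = F (xinf, uinf)"
    and "pinf = ham_x H xinf uinf pinf"
    and "ham_u H xinf uinf pinf = 0"
    and "uinf \<in> interior U"
    and "open W" and "(xinf, uinf) \<in> W" and "C3_on F W" and "C3_on l W"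
    and "det (matrix (blinfun_apply (ham_uu H xinf uinf pinf))) \<noteq> 0"
  \<comment> \<open>implicit control\<close>
    and "open \<Omega>" and "(xinf, pinf) \<in> \<Omega>"
    and "open V" and "uinf \<in> V" and "compact (closure V)" and "closure V \<subseteq> interior U"
    and "C2_on \<nu> \<Omega>" and "\<nu> (xinf, pinf) = uinf"
    and "\<And>x p. (x, p) \<in> \<Omega> \<Longrightarrow> \<nu> (x, p) \<in> V \<and> (x, \<nu> (x, p)) \<in> W \<and> ham_u H x (\<nu> (x, p)) p = 0"
    and "\<And>\<nu>'. C2_on \<nu>' \<Omega> \<Longrightarrow> \<nu>' (xinf, pinf) = uinf \<Longrightarrow>
           (\<And>x p. (x, p) \<in> \<Omega> \<Longrightarrow> \<nu>' (x, p) \<in> V \<and> ham_u H x (\<nu>' (x, p)) p = 0) \<Longrightarrow>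
           (\<And>z. z \<in> \<Omega> \<Longrightarrow> \<nu>' z = \<nu> z)"
    and "Ft = shifted_residual F H \<nu> (xinf, pinf)"
    and "L = fderiv Ft (0, 0)"
  \<comment> \<open>uniform local assumptions\<close>
    and "yinf \<in> Y" and "pinf = rew_x r xinf yinf"
    and "0 \<in> interior Zx" and "0 \<in> interior Zp"
    and "\<And>\<xi> \<pi>. \<xi> \<in> Zx \<Longrightarrow> \<pi> \<in> Zp \<Longrightarrow> (xinf + \<xi>, pinf + \<pi>) \<in> \<Omega>"
    and "convex U0" and "compact (closure U0)" and "closure U0 \<subseteq> interior U"
    and "\<rho>x > 0" and "\<rho>p > 0" and "Bx = cball 0 \<rho>x" and "Bp = cball 0 \<rho>p"
    and "Bx \<subseteq> Zx" and "Bp \<subseteq> Zp"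
    and "yinf \<in> interior Y0" and "compact (closure Y0)" and "closure Y0 \<subseteq> Y"
    and "\<And>\<xi> \<pi>. \<xi> \<in> Zx \<Longrightarrow> \<pi> \<in> Zp \<Longrightarrow> \<nu> (xinf + \<xi>, pinf + \<pi>) \<in> U0"
    and "\<And>z z'. z \<in> Zx \<times> Zp \<Longrightarrow> z' \<in> Zx \<times> Zp \<Longrightarrow>
           norm (fderiv \<nu> ((xinf, pinf) + z)) + norm (fderiv (fderiv \<nu>) ((xinf, pinf) + z')) \<le> Mint"
    and "\<And>z z'. z \<in> Bx \<times> Bp \<Longrightarrow> z' \<in> Bx \<times> Bp \<Longrightarrow> norm (fderiv (fderiv Ft) (z, z')) \<le> Mint"
    and "\<And>y. y \<in> Y \<Longrightarrow> \<exists>X. open X \<and> (\<lambda>\<xi>. xinf + \<xi>) ` Bx \<subseteq> X \<and> C3_on (\<lambda>x. r x y) X"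
    and "\<And>\<xi> y. \<xi> \<in> Bx \<Longrightarrow> y \<in> Y0 \<Longrightarrow>
           norm (fderiv (\<lambda>x. r x y) (xinf + \<xi>)) \<le> Mter \<and>
           norm (fderiv (fderiv (\<lambda>x. r x y)) (xinf + \<xi>)) \<le> Mter \<and>
           norm (fderiv (fderiv (fderiv (\<lambda>x. r x y))) (xinf + \<xi>)) \<le> Mter"
    and "\<And>y \<epsilon>. y \<in> Y0 \<Longrightarrow> \<epsilon> > 0 \<Longrightarrow>
           \<exists>\<eta>>0. \<forall>y'\<in>Y0. dist y' y < \<eta> \<longrightarrow>
             (\<forall>\<xi>\<in>Bx. norm (rew_x r (xinf + \<xi>) y' - rew_x r (xinf + \<xi>) y) < \<epsilon> \<and>
                    norm (rew_xx r (xinf + \<xi>) y' - rew_xx r (xinf + \<xi>) y) < \<epsilon>)"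
  \<comment> \<open>Green property and constants\<close>
    and "\<And>y. DB y = fderiv (bdry r xinf y) (0, 0)"
    and "uniform_green (blinfun_apply L) (\<lambda>h. DB yinf (h, 0)) (\<lambda>h. DB yinf (0, h)) CG \<gamma> T0"
    and "yinf \<in> interior Y1" and "compact (closure Y1)" and "closure Y1 \<subseteq> Y0"
    and "\<theta> = 2 * CG * (SUP y\<in>Y1. norm (rew_xx r xinf y - rew_xx r xinf yinf))" and "\<theta> < 1"
    and "CGbar = CG * (1 + \<theta>) / (1 - \<theta>)"
    and "0 < \<alpha>" and "\<alpha> < \<gamma> / 2"
    and "N = (\<lambda>z z'. Ft (z, z') - L (z, z'))"
    and "\<And>z z'. z \<in> Bx \<times> Bp \<Longrightarrow> z' \<in> Bx \<times> Bp \<Longrightarrow> norm (N z z') \<le> CN * (norm z + norm z')\<^sup>2"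
    and "\<And>z1 z1' z2 z2'. z1 \<in> Bx \<times> Bp \<Longrightarrow> z1' \<in> Bx \<times> Bp \<Longrightarrow> z2 \<in> Bx \<times> Bp \<Longrightarrow> z2' \<in> Bx \<times> Bp \<Longrightarrow>
           norm (N z1 z1' - N z2 z2')
             \<le> CN * (norm z1 + norm z1' + norm z2 + norm z2') * (norm (z1 - z2) + norm (z1' - z2'))"
    and "qm = exp (- (\<gamma> - 2 * \<alpha>))" and "qp = exp (- (\<gamma> + 2 * \<alpha>))"
    and "Cconv = 4 * (1 / (1 - qm) + qp / (1 - qp))"
    and "c = CGbar"
    and "a = 2 * CGbar * Cconv * CN * (1 + exp \<alpha>)\<^sup>2 + 16 * CGbar * Mter"
    and "R > 0" and "2 * a * R < 1"
    and "\<And>T z. T \<ge> T0 \<Longrightarrow> wnorm \<alpha> T z \<le> R \<Longrightarrow> \<forall>t\<le>T. z t \<in> Bx \<times> Bp"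
    and "\<delta> = (R - a * R\<^sup>2) / c"
    and "\<Delta> = Delta_oc r xinf pinf"
    and "K = first_control F H r \<nu> xinf pinf \<alpha> R"
  shows "\<exists>D \<Lambda> C. open D \<and> (xinf, yinf) \<in> D \<and> D \<subseteq> admissible_data r xinf pinf Y1 \<delta> \<and>
    (\<forall>T\<ge>T0. \<forall>y x1 x2. (x1, y) \<in> D \<longrightarrow> (x2, y) \<in> D \<longrightarrow>
       norm (K T x1 y - K T x2 y) \<le> \<Lambda> * norm (x1 - x2)) \<and>
    ((\<forall>y\<in>Y0. \<exists>\<epsilon>>0. \<exists>M. \<forall>\<xi>\<in>Bx.
        M-lipschitz_on (ball y \<epsilon> \<inter> Y0) (\<lambda>y'. rew_x r (xinf + \<xi>) y') \<and>
        M-lipschitz_on (ball y \<epsilon> \<inter> Y0) (\<lambda>y'. rew_xx r (xinf + \<xi>) y')) \<longrightarrow>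
     (\<forall>T\<ge>T0. \<forall>x1 y1 x2 y2. (x1, y1) \<in> D \<longrightarrow> (x2, y2) \<in> D \<longrightarrow>
       norm (K T x1 y1 - K T x2 y2) \<le> \<Lambda> * norm (x1 - x2) + \<Lambda> * norm (y1 - y2))) \<and>
    (\<forall>T\<ge>T0. \<forall>x y. (x, y) \<in> D \<longrightarrow>
       (let h = linear_branch (blinfun_apply L) (blinfun_apply (DB y)) T (\<Delta> x y) in
        norm (K T x y - (uinf + fderiv \<nu> (xinf, pinf) (fst (h 0), snd (h 1))))
          \<le> C * (norm (\<Delta> x y))\<^sup>2))"
proof -
  let ?B0 = "\<lambda>h. blinfun_apply (DB yinf) (h, 0)" and ?BT = "\<lambda>h. blinfun_apply (DB yinf) (0, h)"
  \<comment> \<open>The rows are those at \<open>yinf\<close>, once and for all; every other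
    \<open>y\<close> will be visible in the right-hand sides only.\<close>
  interpret weighted_green "blinfun_apply L" ?B0 ?BT CG \<gamma> \<alpha> T0
    using assms(51,58,59) by unfold_locales auto

  \<comment> \<open>The tube and the bounds on the terminal reward\<close>
  have norm_fst: "norm (fst v) \<le> norm v" and norm_snd: "norm (snd v) \<le> norm v" for v :: "'d phase"
    using norm_fst_le[of "fst v" "snd v"] norm_snd_le[of "snd v" "fst v"] by simp_all
  define S where "S = Bx \<times> Bp"
  define zinf where "zinf = (xinf, pinf)"
  have S: "convex S" "0 \<in> S" and Bx: "convex Bx" "0 \<in> Bx"
    using assms(35-38) by (auto simp: S_def zero_prod_def intro: convex_Times)
  have S_Z: "z \<in> Zx \<times> Zp" if "z \<in> S" for z
    using that assms(39,40) by (auto simp: S_def)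
  have tube: "z t \<in> S" if "T \<ge> T0" "wnorm \<alpha> T z \<le> R" "t \<le> T" for T z t
    using assms(70) that by (auto simp: S_def)
  have Y1_Y0: "y \<in> Y0" if "y \<in> Y1" for y using that assms(54) closure_subset by blast
  have yinf: "yinf \<in> Y1" "yinf \<in> Y0" using assms(52) interior_subset Y1_Y0 by blast+

  have r_C3: "\<exists>X. open X \<and> (\<lambda>\<xi>. xinf + \<xi>) ` Bx \<subseteq> X \<and> C3_on (\<lambda>x. r x y) X" if "y \<in> Y0" for y
    using assms(43,47) closure_subset that by blast
  have rew_x_eq: "(\<lambda>x. rew_x r x y) = grad (\<lambda>x. r x y)" for y
    by (simp add: rew_x_def fun_eq_iff)
  have xinf_in: "xinf \<in> X" if "(\<lambda>\<xi>. xinf + \<xi>) ` Bx \<subseteq> X" for X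
    using that Bx(2) by (metis add.right_neutral image_subset_iff)
  have DB: "DB y (h0, hT) = (fst h0, snd hT - rew_xx r xinf y (fst hT))" if "y \<in> Y0" for y h0 hT
    unfolding assms(50)
  proof (rule fderiv_bdry)
    show "(\<lambda>x. rew_x r x y) differentiable (at xinf)"
      using r_C3[OF that] grad_has_derivative xinf_in unfolding rew_x_eq by (metis differentiableI)
  qed
  have rew_xx_bound: "norm (rew_xx r xinf y) \<le> Mter" if "y \<in> Y0" for y
  proof -
    have "norm (rew_xx r xinf y) \<le> norm (fderiv (fderiv (\<lambda>x. r x y)) xinf)"
      using r_C3[OF that] norm_fderiv_grad_le xinf_in unfolding rew_xx_def rew_x_eq by metis
    then show ?thesis using assms(48)[OF Bx(2) that] by simp
  qed
  have terminal: "norm (rew_x r (xinf + v1) y - rew_x r (xinf + v2) y - rew_xx r xinf y (v1 - v2))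
      \<le> Mter * s * norm (v1 - v2)"
    if "y \<in> Y0" "v1 \<in> Bx" "v2 \<in> Bx" "norm v1 \<le> s" "norm v2 \<le> s" for y v1 v2 s
  proof -
    obtain X where X: "open X" "(\<lambda>\<xi>. xinf + \<xi>) ` Bx \<subseteq> X" "C3_on (\<lambda>x. r x y) X"
      using r_C3[OF \<open>y \<in> Y0\<close>] by blast
    show ?thesis
      using grad_remainder_bound[OF X Bx _ that(2-5), of Mter] assms(48) that(1)
      unfolding rew_xx_def rew_x_eq by (simp add: rew_x_def)
  qed

  \<comment> \<open>Signs and relations of the constants\<close>
  have Mter: "0 \<le> Mter" using rew_xx_bound[OF yinf(2)] norm_ge_zero order_trans by blast
  have Mint: "0 \<le> Mint" "norm (fderiv \<nu> (zinf + v)) \<le> Mint" "norm (fderiv (fderiv \<nu>) (zinf + v)) \<le> Mint"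
    if "v \<in> S" for v
    using assms(45)[OF S_Z[OF that] S_Z[OF that]] norm_ge_zero[of "fderiv \<nu> (zinf + v)"]
      norm_ge_zero[of "fderiv (fderiv \<nu>) (zinf + v)"]
    unfolding zinf_def by linarith+
  have Mint0: "0 \<le> Mint" using Mint(1)[OF S(2)] .
  have CN: "0 \<le> CN"
  proof -
    \<comment> \<open>The sign of \<open>CN\<close> is read off from the quadratic bound at a tube
      point of nonzero norm.\<close>
    obtain v :: "real^'d" where v: "norm v = \<rho>x" using vector_choose_size[of \<rho>x] assms(35) by auto
    have "(v, 0) \<in> S" using v assms(35-38) by (simp add: S_def)
    then have "0 \<le> CN * (norm (v, 0 :: real^'d) + norm (0 :: 'd phase))\<^sup>2"
      using assms(61)[of "(v, 0)" 0] S(2) norm_ge_zero order_trans unfolding S_def by blast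
    then show ?thesis using v assms(35) by (simp add: zero_le_mult_iff norm_Pair)
  qed
  have N0: "N 0 0 = 0" using assms(61)[of 0 0] S(2) by (simp add: S_def)

  have CG: "1 \<le> CG" by (rule C_ge_1)
  have rew_xx_diff: "norm (rew_xx r xinf y - rew_xx r xinf yinf) \<le> \<theta> / (2 * CG)" if "y \<in> Y1" for y
  proof -
    \<comment> \<open>A real \<open>SUP\<close> dominates its members only for a family bounded
      above; \<open>Mter\<close> provides the bound.\<close>
    have "norm (rew_xx r xinf y - rew_xx r xinf yinf) \<le> Mter + Mter" if "y \<in> Y1" for y
      using norm_triangle_ineq4[of "rew_xx r xinf y" "rew_xx r xinf yinf"]
        rew_xx_bound[OF Y1_Y0[OF that]] rew_xx_bound[OF yinf(2)] by linarith
    then have "bdd_above ((\<lambda>y. norm (rew_xx r xinf y - rew_xx r xinf yinf)) ` Y1)"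
      by (auto intro!: bdd_aboveI2)
    from cSUP_upper[OF that this] show ?thesis using CG assms(55) by (simp add: field_simps)
  qed
  have \<theta>: "0 \<le> \<theta>" "\<theta> < 1"
    using rew_xx_diff[OF yinf(1)] CG assms(56) by (auto simp: zero_le_divide_iff)
  have Cconv: "Cconv = conv_const \<gamma> \<alpha>" by (simp add: assms(63-65) conv_const_def)
  have Cconv0: "0 \<le> Cconv"
    using \<alpha> by (auto simp: assms(63-65) intro!: add_nonneg_nonneg)
  have CGbar: "(1 - \<theta>) * CGbar = CG * (1 + \<theta>)" "0 < CGbar"
    using \<theta> CG by (auto simp: assms(57))
  have CG_le: "CG \<le> (1 - \<theta>) * CGbar"
    unfolding CGbar(1) using \<theta> CG by simp
  have a: "0 \<le> a" unfolding assms(67) using CGbar Cconv0 CN Mter by simp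
  have R: "0 < R" and aR: "a * R < 1" using assms(68,69) a by auto
  have \<delta>: "0 < \<delta>" "CGbar * \<delta> = R - a * R\<^sup>2"
    using CGbar aR R by (auto simp: assms(66,71) power2_eq_square)

  \<comment> \<open>In \<open>\<kappa>\<close>, the term \<open>\<theta> / CG\<close> is the row
    difference \<open>\<theta> / (2 * CG)\<close> times the bound 2 on the weight at
    \<open>T\<close>; \<open>4 * Mter * R\<close> is the Taylor remainder on radius
    \<open>2 * R\<close>, again times 2. In \<open>\<psi>\<close>, two sequences of size
    \<open>R\<close> contribute \<open>2 * R\<close> and one factor \<open>1 + exp \<alpha>\<close>,
    their difference the other.\<close>
  define \<kappa> \<psi> q where "\<kappa> = \<theta> / CG + 4 * Mter * R" and "\<psi> = 2 * CN * R * (1 + exp \<alpha>)\<^sup>2"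
    and "q = \<theta> + (1 - \<theta>) * (a * R)"
  have \<kappa>: "0 \<le> \<kappa>" and \<psi>: "0 \<le> \<psi>"
    using \<theta> CG Mter R CN by (auto simp: \<kappa>_def \<psi>_def)
  have q: "0 \<le> q" "q < 1" "CG * (\<kappa> + conv_const \<gamma> \<alpha> * \<psi>) \<le> q"
  proof -
    show "0 \<le> q" using \<theta> a R by (simp add: q_def)
    have "(1 - \<theta>) * (a * R) < (1 - \<theta>) * 1" using aR \<theta> by (intro mult_strict_left_mono) auto
    then show "q < 1" by (simp add: q_def)
    have "CG * (\<kappa> + Cconv * \<psi>) = \<theta> + CG * (4 * Mter * R + Cconv * \<psi>)"
      using CG by (simp add: \<kappa>_def field_simps)
    \<comment> \<open>Replacing \<open>CG\<close> by \<open>(1 - \<theta>) * CGbar\<close> and 4 by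
      16 reproduces the prescribed \<open>a\<close>, so the bound becomes exactly
      \<open>q\<close>.\<close>
    also have "\<dots> \<le> \<theta> + ((1 - \<theta>) * CGbar) * (16 * Mter * R + Cconv * \<psi>)"
      using CG_le CG Mter R Cconv0 \<psi> by (intro add_left_mono mult_mono) auto
    also have "\<dots> = q" by (simp add: q_def assms(67) \<psi>_def algebra_simps)
    finally show "CG * (\<kappa> + conv_const \<gamma> \<alpha> * \<psi>) \<le> q" by (simp add: Cconv)
  qed

  \<comment> \<open>The terminal condition relative to the rows at \<open>yinf\<close>\<close>
  define k where "k y v = (0 :: real^'d, rew_x r (xinf + fst v) y - rew_x r xinf y - rew_xx r xinf yinf (fst v))"
    for y and v :: "'d phase"
  \<comment> \<open>\<open>kl y\<close> is the linear part of \<open>k y\<close> at 0: it has size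
    of order \<open>\<theta>\<close>, and \<open>k y - kl y\<close> is the pure Taylor remainder of
    the reward gradient at \<open>xinf\<close>.\<close>
  define kl where "kl y v = (0 :: real^'d, (rew_xx r xinf y - rew_xx r xinf yinf) (fst v))"
    for y and v :: "'d phase"
  have bdry_iff: "bdry r xinf y (z0, zT) = b \<longleftrightarrow> ?B0 z0 + ?BT zT = b + k y zT" for y z0 zT b
    by (cases z0; cases zT; cases b) (auto simp: DB[OF yinf(2)] bdry_def k_def algebra_simps)
  have DB_iff: "DB y (h0, hT) = b \<longleftrightarrow> ?B0 h0 + ?BT hT = b + kl y hT" if "y \<in> Y1" for y h0 hT b
    by (cases h0; cases hT; cases b)
      (auto simp: DB[OF yinf(2)] DB[OF Y1_Y0[OF that]] kl_def blinfun.diff_left algebra_simps)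
  have kl_lip: "norm (kl y v - kl y v') \<le> \<theta> / (2 * CG) * norm (v - v')" if "y \<in> Y1" for y v v'
  proof -
    have "norm (kl y v - kl y v') = norm ((rew_xx r xinf y - rew_xx r xinf yinf) (fst (v - v')))"
      by (simp add: kl_def norm_Pair blinfun.diff_right)
    also have "\<dots> \<le> norm (rew_xx r xinf y - rew_xx r xinf yinf) * norm (fst (v - v'))"
      by (rule norm_blinfun)
    also have "\<dots> \<le> \<theta> / (2 * CG) * norm (v - v')"
      using rew_xx_diff[OF that] \<theta> CG by (intro mult_mono norm_fst) auto
    finally show ?thesis .
  qed
  have kl_lip': "norm (kl y (z T) - kl y (z' T)) \<le> \<theta> / CG * wnorm \<alpha> T (\<lambda>t. z t - z' t)"
    if "y \<in> Y1" for y z z' T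
  proof -
    have "norm (kl y (z T) - kl y (z' T)) \<le> \<theta> / (2 * CG) * norm (z T - z' T)"
      by (rule kl_lip[OF that])
    also have "\<dots> \<le> \<theta> / (2 * CG) * (2 * wnorm \<alpha> T (\<lambda>t. z t - z' t))"
      using \<theta> CG norm_le_2_wnorm[OF \<alpha>(1), of T T "\<lambda>t. z t - z' t"] by (intro mult_left_mono) auto
    finally show ?thesis by simp
  qed
  have k_kl: "norm ((k y v - k y v') - (kl y v - kl y v')) \<le> Mter * s * norm (v - v')"
    if "y \<in> Y1" "v \<in> S" "v' \<in> S" "norm v \<le> s" "norm v' \<le> s" for y v v' s
  proof -
    have "norm ((k y v - k y v') - (kl y v - kl y v'))
        = norm (rew_x r (xinf + fst v) y - rew_x r (xinf + fst v') y - rew_xx r xinf y (fst v - fst v'))"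
      by (simp add: k_def kl_def norm_Pair blinfun.diff_left blinfun.diff_right algebra_simps)
    also have "\<dots> \<le> Mter * s * norm (fst (v - v'))"
      using that norm_fst[of v] norm_fst[of v']
      unfolding fst_diff by (intro terminal Y1_Y0) (auto simp: S_def)
    also have "\<dots> \<le> Mter * s * norm (v - v')"
      using Mter order_trans[OF norm_ge_zero that(4)] norm_fst[of "v - v'"]
      by (intro mult_left_mono) auto
    finally show ?thesis .
  qed

  \<comment> \<open>The semilinear problem: stability and existence\<close>
  define g where "g z z' = - N z z'" for z z'
  \<comment> \<open>The datum \<open>b\<close> need not have the form \<open>\<Delta> xin y\<close>.
    This freedom lets the zero sequence, or a branch for another parameter, be compared with a given
    branch.\<close>
  define sol where "sol T y b z \<longleftrightarrow> wnorm \<alpha> T z \<le> R \<and> (\<forall>t<T. L (z t, z (Suc t)) = g (z t) (z (Suc t))) \<and>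
      ?B0 (z 0) + ?BT (z T) = b + k y (z T)" for T y b z
  have g_lip: "norm (g (z s) (z (Suc s)) - g (z' s) (z' (Suc s))) \<le> \<psi> * wnorm \<alpha> T (\<lambda>t. z t - z' t) * (weight \<alpha> T s)\<^sup>2"
    if T: "T \<ge> T0" and z: "wnorm \<alpha> T z \<le> R" "wnorm \<alpha> T z' \<le> R" and s: "s < T" for T z z' s
  proof -
    let ?W = "(1 + exp \<alpha>) * weight \<alpha> T s"
    have W: "0 \<le> ?W" using weight_pos[of \<alpha> T s] by (simp add: add_pos_pos less_imp_le)
    have *: "norm (z s) + norm (z (Suc s)) \<le> R * ?W" if "wnorm \<alpha> T z \<le> R" for z :: "nat \<Rightarrow> 'd phase"
      using norm_add_Suc_le_wnorm[OF \<alpha>(1) s, of z] mult_right_mono[OF that W] by linarith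
    have "norm (g (z s) (z (Suc s)) - g (z' s) (z' (Suc s)))
        = norm (N (z s) (z (Suc s)) - N (z' s) (z' (Suc s)))"
      by (simp add: g_def norm_minus_commute)
    also have "\<dots> \<le> CN * (norm (z s) + norm (z (Suc s)) + norm (z' s) + norm (z' (Suc s)))
          * (norm (z s - z' s) + norm (z (Suc s) - z' (Suc s)))"
      using tube[OF T z(1)] tube[OF T z(2)] s by (intro assms(62)) (auto simp: S_def)
    also have "\<dots> \<le> CN * (2 * (R * ?W)) * (wnorm \<alpha> T (\<lambda>t. z t - z' t) * ?W)"
      using *[OF z(1)] *[OF z(2)] norm_add_Suc_le_wnorm[OF \<alpha>(1) s, of "\<lambda>t. z t - z' t"] CN R W
      by (intro mult_mono mult_left_mono mult_nonneg_nonneg add_nonneg_nonneg)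
        (auto simp: less_imp_le weight_pos)
    also have "\<dots> = \<psi> * wnorm \<alpha> T (\<lambda>t. z t - z' t) * (weight \<alpha> T s)\<^sup>2"
      by (simp add: \<psi>_def power2_eq_square algebra_simps)
    finally show ?thesis .
  qed
  have k_lip: "norm (k y (z T) - k y (z' T)) \<le> \<kappa> * wnorm \<alpha> T (\<lambda>t. z t - z' t)"
    if T: "T \<ge> T0" and y: "y \<in> Y1" and z: "wnorm \<alpha> T z \<le> R" "wnorm \<alpha> T z' \<le> R" for T y z z'
  proof -
    let ?d = "wnorm \<alpha> T (\<lambda>t. z t - z' t)"
    have *: "norm (z T) \<le> 2 * R" if "wnorm \<alpha> T z \<le> R" for z :: "nat \<Rightarrow> 'd phase"
      using norm_le_2_wnorm[OF \<alpha>(1), of T T z] that by simp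
    have "norm ((k y (z T) - k y (z' T)) - (kl y (z T) - kl y (z' T))) \<le> Mter * (2 * R) * norm (z T - z' T)"
      using tube[OF T z(1)] tube[OF T z(2)] by (intro k_kl y * z) auto
    also have "\<dots> \<le> Mter * (2 * R) * (2 * ?d)"
      using Mter R norm_le_2_wnorm[OF \<alpha>(1), of T T "\<lambda>t. z t - z' t"] by (intro mult_left_mono) auto
    finally have "norm (k y (z T) - k y (z' T)) \<le> 4 * Mter * R * ?d + norm (kl y (z T) - kl y (z' T))"
      using norm_triangle_sub[of "k y (z T) - k y (z' T)" "kl y (z T) - kl y (z' T)"] by (simp add: mult_ac)
    then show ?thesis using kl_lip'[OF y, of z T z'] by (simp add: \<kappa>_def algebra_simps)
  qed
  have zero: "g 0 0 = 0" "k y 0 = 0" "kl y 0 = 0" for y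
    by (simp_all add: g_def N0 k_def kl_def prod_eq_iff)

  define cs where "cs = CG / (1 - q)"
  have cs: "0 \<le> cs" using CG q by (simp add: cs_def)
  have L_diff: "L (z t - z' t, z t' - z' t') = L (z t, z t') - L (z' t, z' t')" for z z' :: "nat \<Rightarrow> 'd phase" and t t'
    by (simp add: blinfun.diff_right[symmetric])
  have B_diff: "?B0 (z 0 - z' 0) + ?BT (z T - z' T) = (?B0 (z 0) + ?BT (z T)) - (?B0 (z' 0) + ?BT (z' T))"
    for z z' :: "nat \<Rightarrow> 'd phase" and T
    by (simp add: linear_diff[OF linear(2)] linear_diff[OF linear(3)])
  have stability: "wnorm \<alpha> T (\<lambda>t. z t - z' t) \<le> cs * norm (b - b')"
    if T: "T \<ge> T0" and y: "y \<in> Y1" and z: "sol T y b z" "sol T y b' z'" for T y b b' z z'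
  proof -
    let ?d = "\<lambda>t. z t - z' t"
    have "wnorm \<alpha> T ?d \<le> CG * (norm (b - b') + conv_const \<gamma> \<alpha> * 0) / (1 - q)"
    proof (rule wnorm_le_perturbed[OF T _ _ q(3,2)])
      show "norm (L (?d s, ?d (Suc s))) \<le> (0 + \<psi> * wnorm \<alpha> T ?d) * (weight \<alpha> T s)\<^sup>2" if "s < T" for s
        using z that g_lip[OF T _ _ that, of z z'] by (simp add: L_diff sol_def)
      have "?B0 (?d 0) + ?BT (?d T) = (b - b') + (k y (z T) - k y (z' T))"
        unfolding B_diff using z by (simp add: sol_def)
      then show "norm (?B0 (?d 0) + ?BT (?d T)) \<le> norm (b - b') + \<kappa> * wnorm \<alpha> T ?d"
        using norm_triangle_ineq[of "b - b'" "k y (z T) - k y (z' T)"] k_lip[OF T y, of z z'] z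
        by (simp add: sol_def)
    qed
    then show ?thesis by (simp add: cs_def)
  qed
  have existence: "\<exists>z\<in>extensional {..T}. sol T y b z"
    if T: "T \<ge> T0" and y: "y \<in> Y1" and b: "norm b < \<delta>" for T y b
    unfolding sol_def
  proof (rule semilinear_bvp_solvable[OF T _ g_lip[OF T] k_lip[OF T y] zero(1,2) \<psi> \<kappa> q(3,1,2)])
    have "CG * norm b \<le> ((1 - \<theta>) * CGbar) * \<delta>"
      using CG_le CG b by (intro mult_mono) auto
    also have "\<dots> = (1 - \<theta>) * (R - a * R\<^sup>2)"
      by (simp add: \<delta>(2) mult.assoc)
    finally show "CG * norm b + q * R \<le> R"
      by (simp add: q_def algebra_simps power2_eq_square)
  qed (use R in auto)

  \<comment> \<open>Branches as solutions of the semilinear problem\<close>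
  have branch_iff: "stationary_branch F H r \<nu> xinf pinf \<alpha> R T xin y z
      \<longleftrightarrow> z \<in> extensional {..T} \<and> sol T y (\<Delta> xin y) z"
    if T: "T \<ge> T0" for T xin y z
  proof (cases "wnorm \<alpha> T z \<le> R")
    case True
    have dyn: "(xinf + fst (z (Suc t)) = F (xinf + fst (z t), \<nu> (xinf + fst (z t), pinf + snd (z (Suc t)))) \<and>
        pinf + snd (z t) = ham_x H (xinf + fst (z t)) (\<nu> (xinf + fst (z t), pinf + snd (z (Suc t)))) (pinf + snd (z (Suc t))) \<and>
        ham_u H (xinf + fst (z t)) (\<nu> (xinf + fst (z t), pinf + snd (z (Suc t)))) (pinf + snd (z (Suc t))) = 0)
      \<longleftrightarrow> L (z t, z (Suc t)) = g (z t) (z (Suc t))" if t: "t < T" for t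
    proof -
      \<comment> \<open>The control is evaluated at a state and a costate of different times; this
        mixed point stays in the domain because the neighborhood is a product. Stationarity in
        \<open>u\<close> then holds by construction of \<open>\<nu>\<close>.\<close>
      have "(xinf + fst (z t), pinf + snd (z (Suc t))) \<in> \<Omega>"
        using S_Z[OF tube[OF T True, of t]] S_Z[OF tube[OF T True, of "Suc t"]] t
        by (intro assms(31)) auto
      then have "ham_u H (xinf + fst (z t)) (\<nu> (xinf + fst (z t), pinf + snd (z (Suc t)))) (pinf + snd (z (Suc t))) = 0"
        using assms(23) by blast
      moreover have "L (z t, z (Suc t)) = g (z t) (z (Suc t)) \<longleftrightarrow> Ft (z t, z (Suc t)) = 0"
        by (auto simp: g_def assms(60))
      moreover have "Ft (z t, z (Suc t)) = 0 \<longleftrightarrow>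
          xinf + fst (z (Suc t)) = F (xinf + fst (z t), \<nu> (xinf + fst (z t), pinf + snd (z (Suc t)))) \<and>
          pinf + snd (z t) = ham_x H (xinf + fst (z t)) (\<nu> (xinf + fst (z t), pinf + snd (z (Suc t)))) (pinf + snd (z (Suc t)))"
        by (cases "z t"; cases "z (Suc t)") (simp add: assms(25) shifted_residual_def pmp_residual_def zero_prod_def)
      ultimately show ?thesis by blast
    qed
    have bd: "xinf + fst (z 0) = xin \<and> pinf + snd (z T) = rew_x r (xinf + fst (z T)) y
        \<longleftrightarrow> ?B0 (z 0) + ?BT (z T) = \<Delta> xin y + k y (z T)"
      unfolding bdry_iff[symmetric]
      by (cases "z 0"; cases "z T") (auto simp: assms(72) Delta_oc_def bdry_def algebra_simps)
    show ?thesis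
      unfolding stationary_branch_def Let_def sol_def using True dyn bd by blast
  qed (simp add: stationary_branch_def sol_def)

  \<comment> \<open>The first control as a function of the boundary data\<close>
  define first where "first z = (fst (z 0), snd (z 1))" for z :: "nat \<Rightarrow> 'd phase"
  \<comment> \<open>Time 1 lies within the horizon because \<open>T0 \<ge> 1\<close>.\<close>
  have first: "first z \<in> S" if "T \<ge> T0" "wnorm \<alpha> T z \<le> R" for T z
    using tube[OF that, of 0] tube[OF that, of 1] that(1) T\<^sub>0_ge_1 by (auto simp: S_def first_def mem_Times_iff)
  have norm_first: "norm (first z) \<le> 4 * wnorm \<alpha> T z" if "T \<ge> T0" for T z
  proof -
    have "norm (first z) \<le> norm (fst (z 0)) + norm (snd (z 1))" by (simp add: first_def norm_Pair_le)
    also have "\<dots> \<le> norm (z 0) + norm (z 1)"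
      by (intro add_mono norm_fst norm_snd)
    also have "\<dots> \<le> 2 * wnorm \<alpha> T z + 2 * wnorm \<alpha> T z"
      using that T\<^sub>0_ge_1 by (intro add_mono norm_le_2_wnorm \<alpha>) auto
    finally show ?thesis by simp
  qed
  have first_diff: "first (\<lambda>t. z t - z' t) = first z - first z'" for z z'
    by (simp add: first_def)
  have K: "\<exists>z. sol T y (\<Delta> x y) z \<and> K T x y = \<nu> (zinf + first z)"
    if T: "T \<ge> T0" and y: "y \<in> Y1" and b: "norm (\<Delta> x y) < \<delta>" for T x y
  proof -
    obtain z where z: "z \<in> extensional {..T}" "sol T y (\<Delta> x y) z"
      using existence[OF T y b] by blast
    \<comment> \<open>Equal data make the stability bound 0, hence equality on \<open>{..T}\<close>;
      \<open>extensional\<close> upgrades it to equality of functions, as the definite description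
      in \<open>local_branch\<close> requires.\<close>
    have "z' = z" if "z' \<in> extensional {..T}" "sol T y (\<Delta> x y) z'" for z'
    proof (rule extensionalityI[OF that(1) z(1)])
      fix t assume "t \<in> {..T}"
      then show "z' t = z t"
        using stability[OF T y that(2) z(2)] by (intro wnorm_diff_le_0_imp_eq[where z = z' and \<alpha> = \<alpha> and T = T]) auto
    qed
    then have "local_branch F H r \<nu> xinf pinf \<alpha> R T x y = z"
      unfolding local_branch_def branch_iff[OF T] using z by blast
    then show ?thesis
      using z(2) by (auto simp: assms(73) first_control_def Let_def first_def zinf_def)
  qed
  have \<nu>_diff: "\<nu> differentiable (at (zinf + v))" "fderiv \<nu> differentiable (at (zinf + v))" if "v \<in> S" for v
  proof -
    have "zinf + v \<in> \<Omega>"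
      using assms(31)[of "fst v" "snd v"] S_Z[OF that] by (cases v) (auto simp: zinf_def)
    then show "\<nu> differentiable (at (zinf + v))" "fderiv \<nu> differentiable (at (zinf + v))"
      using assms(21) by (auto simp: C2_on_def C1_on_def)
  qed
  have \<nu>_lip: "norm (\<nu> (zinf + v) - \<nu> (zinf + v')) \<le> Mint * norm (v - v')" if "v \<in> S" "v' \<in> S" for v v'
    by (rule differentiable_bound[OF S(1), where f' = "\<lambda>v. blinfun_apply (fderiv \<nu> (zinf + v))"])
      (use that Mint(2) \<nu>_diff in \<open>auto simp: norm_blinfun.rep_eq[symmetric] intro!: has_derivative_fderiv_shift\<close>)

  define \<Lambda>\<^sub>0 where "\<Lambda>\<^sub>0 = Mint * (4 * cs)"
  have \<Lambda>\<^sub>0: "0 \<le> \<Lambda>\<^sub>0" using Mint0 cs by (simp add: \<Lambda>\<^sub>0_def)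
  have control_lip: "norm (\<nu> (zinf + first z) - \<nu> (zinf + first z')) \<le> \<Lambda>\<^sub>0 * norm (b - b')"
    if T: "T \<ge> T0" and y: "y \<in> Y1" and z: "sol T y b z" "sol T y b' z'" for T y b b' z z'
  proof -
    have "norm (\<nu> (zinf + first z) - \<nu> (zinf + first z')) \<le> Mint * norm (first (\<lambda>t. z t - z' t))"
      unfolding first_diff using z by (intro \<nu>_lip first[OF T]) (auto simp: sol_def)
    also have "\<dots> \<le> Mint * (4 * (cs * norm (b - b')))"
      using norm_first[OF T, of "\<lambda>t. z t - z' t"] stability[OF T y z] Mint0 by (intro mult_left_mono) auto
    finally show ?thesis by (simp add: \<Lambda>\<^sub>0_def mult_ac)
  qed

  \<comment> \<open>The error of the linearized branch\<close>
  define E where "E = CG * (4 * Mter + conv_const \<gamma> \<alpha> * (CN * (1 + exp \<alpha>)\<^sup>2)) / (1 - \<theta>)"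
  have linear_error: "norm (K T x y - (uinf + fderiv \<nu> zinf (first h))) \<le> (Mint * (16 + 4 * E) * cs\<^sup>2) * (norm (\<Delta> x y))\<^sup>2"
    if T: "T \<ge> T0" and y: "y \<in> Y1" and b: "norm (\<Delta> x y) < \<delta>"
      and h_eq: "h = linear_branch (blinfun_apply L) (blinfun_apply (DB y)) T (\<Delta> x y)" for T x y h
  proof -
    define lin where "lin h \<longleftrightarrow> (\<forall>t<T. L (h t, h (Suc t)) = 0) \<and> DB y (h 0, h T) = \<Delta> x y" for h
    have q_lin: "CG * (\<theta> / CG + conv_const \<gamma> \<alpha> * 0) \<le> \<theta>" using CG by simp
    \<comment> \<open>Solvability with the rows at \<open>y\<close> is again a perturbation of the
      rows at \<open>yinf\<close>, now without nonlinearity, so the contraction factor is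
      \<open>\<theta>\<close>. The radius is the solution of
      \<open>CG * norm (\<Delta> x y) + \<theta> * r = r\<close>.\<close>
    have "\<exists>h\<in>extensional {..T}. wnorm \<alpha> T h \<le> CG * norm (\<Delta> x y) / (1 - \<theta>) \<and>
        (\<forall>t<T. L (h t, h (Suc t)) = 0) \<and> ?B0 (h 0) + ?BT (h T) = \<Delta> x y + kl y (h T)"
    proof (rule semilinear_bvp_solvable[OF T, where g = "\<lambda>_ _. 0" and \<psi> = 0 and \<kappa> = "\<theta> / CG" and q = \<theta>])
      show "CG * norm (\<Delta> x y) + \<theta> * (CG * norm (\<Delta> x y) / (1 - \<theta>)) \<le> CG * norm (\<Delta> x y) / (1 - \<theta>)"
        using \<theta> by (simp add: divide_simps) (simp add: algebra_simps)
      show "norm (kl y (z T) - kl y (z' T)) \<le> \<theta> / CG * wnorm \<alpha> T (\<lambda>t. z t - z' t)" for z z'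
        by (rule kl_lip'[OF y])
    qed (use CG \<theta> zero(3) in simp_all)
    then obtain h' where h': "h' \<in> extensional {..T}" "lin h'"
      unfolding lin_def DB_iff[OF y] by blast
    have unique: "h'' = h'" if "h'' \<in> extensional {..T}" "lin h''" for h''
    proof (rule extensionalityI[OF that(1) h'(1)])
      let ?d = "\<lambda>t. h'' t - h' t"
      have "wnorm \<alpha> T ?d \<le> CG * (0 + conv_const \<gamma> \<alpha> * 0) / (1 - \<theta>)"
      proof (rule wnorm_le_perturbed[OF T _ _ q_lin \<theta>(2)])
        show "norm (L (?d s, ?d (Suc s))) \<le> (0 + 0 * wnorm \<alpha> T ?d) * (weight \<alpha> T s)\<^sup>2" if "s < T" for s
          using that h'(2) \<open>lin h''\<close> unfolding L_diff lin_def by simp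
        show "norm (?B0 (?d 0) + ?BT (?d T)) \<le> 0 + \<theta> / CG * wnorm \<alpha> T ?d"
          unfolding B_diff using h'(2) \<open>lin h''\<close> kl_lip'[OF y, of h'' T h'] by (simp add: lin_def DB_iff[OF y])
      qed
      then show "h'' t = h' t" if "t \<in> {..T}" for t
        using that by (intro wnorm_diff_le_0_imp_eq[where z = h'' and \<alpha> = \<alpha> and T = T]) auto
    qed
    have "h = h'"
      unfolding h_eq linear_branch_def
    proof (rule the_equality)
      show "h' \<in> extensional {..T} \<and> (\<forall>t<T. L (h' t, h' (Suc t)) = 0) \<and> DB y (h' 0, h' T) = \<Delta> x y"
        using h' unfolding lin_def by blast
    qed (use unique lin_def in blast)
    then have h: "lin h" using h' by simp

    obtain z where z: "sol T y (\<Delta> x y) z" and Kz: "K T x y = \<nu> (zinf + first z)"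
      using K[OF T y b] by blast
    have zR: "wnorm \<alpha> T z \<le> R" using z by (simp add: sol_def)
    \<comment> \<open>Stability against the zero solution bounds the branch linearly by its data,
      which later turns its square into the square of \<open>norm (\<Delta> x y)\<close>.\<close>
    have "sol T y 0 (\<lambda>_. 0)"
      using R zero by (simp add: sol_def wnorm_def zero_prod_def[symmetric])
    from stability[OF T y z this] have wz: "wnorm \<alpha> T z \<le> cs * norm (\<Delta> x y)" by simp
    let ?e = "\<lambda>t. z t - h t" and ?w = "wnorm \<alpha> T z"
    have we: "wnorm \<alpha> T ?e \<le> CG * (4 * Mter * ?w\<^sup>2 + conv_const \<gamma> \<alpha> * (CN * (1 + exp \<alpha>)\<^sup>2 * ?w\<^sup>2)) / (1 - \<theta>)"
    proof (rule wnorm_le_perturbed[OF T _ _ q_lin \<theta>(2)])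
      fix s assume s: "s < T"
      have "norm (L (?e s, ?e (Suc s))) = norm (N (z s) (z (Suc s)))"
        using h z s by (simp add: L_diff lin_def sol_def g_def)
      also have "\<dots> \<le> CN * (norm (z s) + norm (z (Suc s)))\<^sup>2"
        using tube[OF T zR] s by (intro assms(61)) (auto simp: S_def)
      also have "\<dots> \<le> CN * (?w * ((1 + exp \<alpha>) * weight \<alpha> T s))\<^sup>2"
        using CN norm_add_Suc_le_wnorm[OF \<alpha>(1) s, of z] by (intro mult_left_mono power_mono) auto
      finally show "norm (L (?e s, ?e (Suc s)))
          \<le> (CN * (1 + exp \<alpha>)\<^sup>2 * ?w\<^sup>2 + 0 * wnorm \<alpha> T ?e) * (weight \<alpha> T s)\<^sup>2"
        by (simp add: power_mult_distrib mult_ac)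
    next
      have zT: "norm (z T) \<le> 2 * ?w" by (rule norm_le_2_wnorm[OF \<alpha>(1)]) simp
      have "norm ((k y (z T) - k y 0) - (kl y (z T) - kl y 0)) \<le> Mter * (2 * ?w) * norm (z T - 0)"
        using tube[OF T zR, of T] S(2) zT wnorm_nonneg[of \<alpha> T z] by (intro k_kl[OF y]) auto
      also have "\<dots> \<le> Mter * (2 * ?w) * (2 * ?w)"
        using zT Mter wnorm_nonneg[of \<alpha> T z] by (intro mult_left_mono) auto
      finally have "norm (k y (z T) - kl y (z T)) \<le> 4 * Mter * ?w\<^sup>2"
        by (simp add: zero power2_eq_square mult_ac)
      \<comment> \<open>The first bracket is quadratic in the branch; the second is proportional to
        the error itself and is absorbed with factor \<open>\<theta>\<close>.\<close>
      moreover have "?B0 (?e 0) + ?BT (?e T) = (k y (z T) - kl y (z T)) + (kl y (z T) - kl y (h T))"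
        unfolding B_diff using h z by (simp add: lin_def sol_def DB_iff[OF y])
      ultimately show "norm (?B0 (?e 0) + ?BT (?e T)) \<le> 4 * Mter * ?w\<^sup>2 + \<theta> / CG * wnorm \<alpha> T ?e"
        using norm_triangle_ineq[of "k y (z T) - kl y (z T)" "kl y (z T) - kl y (h T)"]
          kl_lip'[OF y, of z T h] by simp
    qed
    then have we: "wnorm \<alpha> T ?e \<le> E * ?w\<^sup>2" by (simp add: E_def algebra_simps)
    \<comment> \<open>Taking the radius equal to \<open>norm (first z)\<close> and the second point
      0 makes the two-point remainder quadratic.\<close>
    have "norm (\<nu> (zinf + first z) - \<nu> (zinf + 0) - fderiv \<nu> zinf (first z - 0))
        \<le> Mint * norm (first z) * norm (first z - 0)"
      by (rule derivative_remainder_bound[OF S]) (use \<nu>_diff Mint(3) first[OF T zR] S(2) in auto)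
    moreover have "norm (fderiv \<nu> zinf (first ?e)) \<le> Mint * norm (first ?e)"
      using Mint(2)[OF S(2)] norm_blinfun[of "fderiv \<nu> zinf" "first ?e"]
        mult_right_mono[of "norm (fderiv \<nu> zinf)" Mint "norm (first ?e)"] by simp
    moreover have "K T x y - (uinf + fderiv \<nu> zinf (first h))
        = (\<nu> (zinf + first z) - \<nu> (zinf + 0) - fderiv \<nu> zinf (first z - 0)) + fderiv \<nu> zinf (first ?e)"
      using assms(22) by (simp add: Kz zinf_def first_diff blinfun.diff_right)
    ultimately have "norm (K T x y - (uinf + fderiv \<nu> zinf (first h)))
        \<le> Mint * (norm (first z) * norm (first z)) + Mint * norm (first ?e)"
      using norm_triangle_ineq[of "\<nu> (zinf + first z) - \<nu> (zinf + 0) - fderiv \<nu> zinf (first z - 0)"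
          "fderiv \<nu> zinf (first ?e)"] by simp
    also have "\<dots> \<le> Mint * ((4 * ?w) * (4 * ?w)) + Mint * (4 * (E * ?w\<^sup>2))"
      using norm_first[OF T, of z] norm_first[OF T, of ?e] we Mint0 wnorm_nonneg[of \<alpha> T z]
      by (intro add_mono mult_left_mono mult_mono) auto
    also have "\<dots> = Mint * (16 + 4 * E) * ?w\<^sup>2"
      by (simp add: algebra_simps power2_eq_square)
    also have "\<dots> \<le> Mint * (16 + 4 * E) * (cs * norm (\<Delta> x y))\<^sup>2"
    proof (intro mult_left_mono power_mono wz wnorm_nonneg)
      show "0 \<le> Mint * (16 + 4 * E)"
        using Mint0 CG Mter Cconv0 CN \<theta> by (simp add: E_def Cconv)
    qed
    finally show ?thesis by (simp add: power_mult_distrib mult_ac)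
  qed

  \<comment> \<open>The neighborhood of endpoint data and the conclusion\<close>
  let ?Lip = "\<forall>y\<in>Y0. \<exists>\<epsilon>>0. \<exists>M. \<forall>\<xi>\<in>Bx.
        M-lipschitz_on (ball y \<epsilon> \<inter> Y0) (\<lambda>y'. rew_x r (xinf + \<xi>) y') \<and>
        M-lipschitz_on (ball y \<epsilon> \<inter> Y0) (\<lambda>y'. rew_xx r (xinf + \<xi>) y')"
  \<comment> \<open>\<open>D\<close> and \<open>\<Lambda>\<close> are chosen before the Lipschitz
    hypothesis is assumed, so \<open>\<epsilon>\<close> and \<open>M\<close> must exist in either
    case; without it the values 1 and 0 serve.\<close>
  obtain \<epsilon> M where \<epsilon>: "0 < \<epsilon>" and M: "0 \<le> M"
    and lip: "?Lip \<Longrightarrow> \<xi> \<in> Bx \<Longrightarrow> y1 \<in> ball yinf \<epsilon> \<inter> Y0 \<Longrightarrow> y2 \<in> ball yinf \<epsilon> \<inter> Y0 \<Longrightarrow>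
      norm (rew_x r (xinf + \<xi>) y1 - rew_x r (xinf + \<xi>) y2) \<le> M * norm (y1 - y2)" for \<xi> y1 y2
  proof (cases ?Lip)
    case True
    then obtain \<epsilon> M where "0 < \<epsilon>"
      and *: "\<And>\<xi>. \<xi> \<in> Bx \<Longrightarrow> M-lipschitz_on (ball yinf \<epsilon> \<inter> Y0) (\<lambda>y'. rew_x r (xinf + \<xi>) y')"
      using yinf(2) by meson
    then show thesis
      using that[of \<epsilon> M] lipschitz_on_nonneg[OF *[OF Bx(2)]] lipschitz_onD[OF *] by (auto simp: dist_norm)
  qed (use that[of 1 0] in auto)
  obtain \<eta>1 where \<eta>1: "0 < \<eta>1" "ball yinf \<eta>1 \<subseteq> Y1" using assms(52) mem_interior by blast
  obtain \<eta>2 where \<eta>2: "0 < \<eta>2" "\<And>y. y \<in> Y0 \<Longrightarrow> dist y yinf < \<eta>2 \<Longrightarrow> norm (rew_x r xinf y - rew_x r xinf yinf) < \<delta> / 2"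
    using assms(49)[OF yinf(2), of "\<delta> / 2"] \<delta>(1) Bx(2) by (metis add.right_neutral half_gt_zero)
  \<comment> \<open>Each component of the endpoint data gets half of \<open>\<delta>\<close>: the
    state by its ball, the reward gradient by \<open>\<eta>2\<close>.\<close>
  define D where "D = ball xinf (\<delta> / 2) \<times> ball yinf (min \<epsilon> (min \<eta>1 \<eta>2))"
  have D: "y \<in> Y1" "y \<in> ball yinf \<epsilon> \<inter> Y0" "norm (\<Delta> x y) < \<delta>" if "(x, y) \<in> D" for x y
  proof -
    show y: "y \<in> Y1" using that \<eta>1 by (auto simp: D_def)
    then show "y \<in> ball yinf \<epsilon> \<inter> Y0" using that Y1_Y0 by (auto simp: D_def)
    have "norm (\<Delta> x y) \<le> norm (x - xinf) + norm (rew_x r xinf y - pinf)"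
      by (simp add: assms(72) Delta_oc_def norm_Pair_le)
    also have "\<dots> < \<delta> / 2 + \<delta> / 2"
      using that \<eta>2(2)[OF Y1_Y0[OF y]]
      by (intro add_strict_mono) (auto simp: D_def assms(28)[symmetric] dist_norm norm_minus_commute)
    finally show "norm (\<Delta> x y) < \<delta>" by simp
  qed
  show ?thesis
  proof (intro exI conjI)
    show "open D" by (simp add: D_def open_Times)
    show "(xinf, yinf) \<in> D" using \<delta> \<epsilon> \<eta>1 \<eta>2 by (simp add: D_def)
    show "D \<subseteq> admissible_data r xinf pinf Y1 \<delta>"
      using D by (auto simp: admissible_data_def assms(72))
    \<comment> \<open>One constant has to serve both Lipschitz claims, hence the enlargement by
      \<open>1 + M\<close>.\<close>
    have \<Lambda>_le: "\<Lambda>\<^sub>0 * X \<le> \<Lambda>\<^sub>0 * (1 + M) * X" if "0 \<le> X" for X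
      using \<Lambda>\<^sub>0 M that by (simp add: algebra_simps)
    show "\<forall>T\<ge>T0. \<forall>y x1 x2. (x1, y) \<in> D \<longrightarrow> (x2, y) \<in> D \<longrightarrow>
       norm (K T x1 y - K T x2 y) \<le> (\<Lambda>\<^sub>0 * (1 + M)) * norm (x1 - x2)"
    proof (intro allI impI)
      fix T y x1 x2 assume T: "T \<ge> T0" and x: "(x1, y) \<in> D" "(x2, y) \<in> D"
      obtain z1 z2 where z: "sol T y (\<Delta> x1 y) z1" "sol T y (\<Delta> x2 y) z2"
        and Kz: "K T x1 y = \<nu> (zinf + first z1)" "K T x2 y = \<nu> (zinf + first z2)"
        using K[OF T D(1,3)[OF x(1)]] K[OF T D(1,3)[OF x(2)]] by blast
      have "\<Delta> x1 y - \<Delta> x2 y = (x1 - x2, 0)" by (simp add: assms(72) Delta_oc_def)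
      then show "norm (K T x1 y - K T x2 y) \<le> (\<Lambda>\<^sub>0 * (1 + M)) * norm (x1 - x2)"
        using control_lip[OF T D(1)[OF x(1)] z] \<Lambda>_le[of "norm (x1 - x2)"] by (simp add: Kz norm_Pair)
    qed
    show "?Lip \<longrightarrow> (\<forall>T\<ge>T0. \<forall>x1 y1 x2 y2. (x1, y1) \<in> D \<longrightarrow> (x2, y2) \<in> D \<longrightarrow>
       norm (K T x1 y1 - K T x2 y2) \<le> (\<Lambda>\<^sub>0 * (1 + M)) * norm (x1 - x2) + (\<Lambda>\<^sub>0 * (1 + M)) * norm (y1 - y2))"
    proof (intro allI impI)
      fix T x1 y1 x2 y2 assume Lip: ?Lip and T: "T \<ge> T0" and x: "(x1, y1) \<in> D" "(x2, y2) \<in> D"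
      obtain z1 z2 where z: "sol T y1 (\<Delta> x1 y1) z1" "sol T y2 (\<Delta> x2 y2) z2"
        and Kz: "K T x1 y1 = \<nu> (zinf + first z1)" "K T x2 y2 = \<nu> (zinf + first z2)"
        using K[OF T D(1,3)[OF x(1)]] K[OF T D(1,3)[OF x(2)]] by blast
      \<comment> \<open>The second branch also solves the problem for \<open>y1\<close>, with the change of the terminal reward
        moved into the boundary data.\<close>
      define b where "b = \<Delta> x2 y2 + k y2 (z2 T) - k y1 (z2 T)"
      have "sol T y1 b z2" using z(2) by (simp add: sol_def b_def)
      from control_lip[OF T D(1)[OF x(1)] z(1) this]
      have "norm (K T x1 y1 - K T x2 y2) \<le> \<Lambda>\<^sub>0 * norm (\<Delta> x1 y1 - b)" by (simp add: Kz)
      also have "\<Delta> x1 y1 - b = (x1 - x2, rew_x r (xinf + fst (z2 T)) y1 - rew_x r (xinf + fst (z2 T)) y2)"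
        by (simp add: b_def assms(72) Delta_oc_def k_def)
      also have "\<Lambda>\<^sub>0 * norm \<dots> \<le> \<Lambda>\<^sub>0 * (norm (x1 - x2) + M * norm (y1 - y2))"
      proof (intro mult_left_mono \<Lambda>\<^sub>0 order_trans[OF norm_Pair_le] add_left_mono)
        have "z2 T \<in> S" using tube[OF T] z(2) by (simp add: sol_def)
        then show "norm (rew_x r (xinf + fst (z2 T)) y1 - rew_x r (xinf + fst (z2 T)) y2) \<le> M * norm (y1 - y2)"
          using lip[OF Lip _ D(2)[OF x(1)] D(2)[OF x(2)]] by (auto simp: S_def)
      qed
      also have "\<dots> \<le> \<Lambda>\<^sub>0 * ((1 + M) * norm (x1 - x2) + (1 + M) * norm (y1 - y2))"
        using \<Lambda>\<^sub>0 M by (intro mult_left_mono add_mono) (auto simp: algebra_simps)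
      finally show "norm (K T x1 y1 - K T x2 y2)
          \<le> (\<Lambda>\<^sub>0 * (1 + M)) * norm (x1 - x2) + (\<Lambda>\<^sub>0 * (1 + M)) * norm (y1 - y2)"
        by (simp add: algebra_simps)
    qed
    show "\<forall>T\<ge>T0. \<forall>x y. (x, y) \<in> D \<longrightarrow>
       (let h = linear_branch (blinfun_apply L) (blinfun_apply (DB y)) T (\<Delta> x y) in
        norm (K T x y - (uinf + fderiv \<nu> (xinf, pinf) (fst (h 0), snd (h 1))))
          \<le> (Mint * (16 + 4 * E) * cs\<^sup>2) * (norm (\<Delta> x y))\<^sup>2)"
      using linear_error[OF _ D(1,3) refl] by (simp add: Let_def first_def zinf_def)
  qed
qed

end
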